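(* Let $(\mathcal C,\otimes,I)$ be a monoidal category, let $\mathcal C_0\subset\mathcal C$ be a subcategory which is right coclosed in $\mathcal C$, let $\mathcal D$ be a category, and let $F:\mathcal D\to\mathcal C_0\subset\mathcal C$ be a functor. Suppose that $\mathrm{coend}(F)$ exists, with universal cowedge $i_X:\mathrm{cohom}_{\mathcal C}(F(X),F(X))\to\mathrm{coend}(F)$, $X\in\mathcal D$. Then: (1) $\mathrm{coend}(F)$ is a coalgebra in $\mathcal C$ (with comultiplication and counit induced, through the universal cowedge, by those of the coalgebras $\mathrm{cohom}_{\mathcal C}(F(X),F(X))$); (2) for every object $X$ of $\mathcal D$, $F(X)$ is a right comodule over $\mathrm{coend}(F)$, with coaction $\delta_F(X):=(\mathrm{id}_{F(X)}\otimes i_X)\circ\mathrm{coev}_{F(X),F(X)}$; (3) for every morphism $\phi\in\mathcal D(X,Y)$, $F(\phi):F(X)\to F(Y)$ is a morphism of $\mathrm{coend}(F)$-comodules; (4) the family $\delta_F:F\to F\otimes\mathrm{coend}(F)$ of the coactions from (2) is a natural transformation; (5) $\delta_F$ is universal, i.e. for every object $M\in\mathcal C$, any natural transformation $F\to F\otimes M$ factors through $\delta_F$ via a morphism $\mathrm{coend}(F)\to M$.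
   Context: Cohomomorphism objects: for objects $X,Y$ of a monoidal category $(\mathcal C,\otimes,I)$, a (right) cohomomorphism object is an object $\mathrm{cohom}_{\mathcal C}(X,Y)$ with a morphism $\mathrm{coev}_{X,Y}:X\to Y\otimes\mathrm{cohom}_{\mathcal C}(X,Y)$ such that for every $Z\in\mathcal C$ and every $\phi:X\to Y\otimes Z$ there is a unique $\mathrm{coact}(\phi):\mathrm{cohom}_{\mathcal C}(X,Y)\to Z$ with $(\mathrm{id}_Y\otimes\mathrm{coact}(\phi))\circ\mathrm{coev}_{X,Y}=\phi$. A subcategory $\mathcal C_0\subset\mathcal C$ is right coclosed in $\mathcal C$ if $\mathrm{cohom}_{\mathcal C}(X,Y)\in\mathcal C$ exists for all $X,Y\in\mathcal C_0$. Then $\mathrm{Cohom}_{\mathcal C}$ is a bifunctor $\mathcal C_0\times\mathcal C_0^{op}\to\mathcal C$, covariant in the first and contravariant in the second variable: for $f:X\to X'$, $\mathrm{cohom}(f,\mathrm{id}_Y)=\mathrm{coact}(\mathrm{coev}_{X',Y}\circ f)$, and for $g:Y\to Y'$, $\mathrm{cohom}(\mathrm{id}_X,g^{op})=\mathrm{coact}((g\otimes\mathrm{id})\circ\mathrm{coev}_{X,Y}):\mathrm{cohom}(X,Y')\to\mathrm{cohom}(X,Y)$. Each $\mathrm{cohom}_{\mathcal C}(X,X)$ is a coalgebra with comultiplication $\mathrm{coact}((\mathrm{coev}_{X,X}\otimes\mathrm{id})\circ\mathrm{coev}_{X,X})$ and counit $\mathrm{coact}(\mathrm{id}_X)$. Cowedges: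 for a bifunctor $G:\mathcal D\times\mathcal D^{op}\to\mathcal C$, a cowedge from $G$ to $d\in\mathcal C$ is a family $\mu_c:G(c,c)\to d$ ($c\in\mathcal D$) such that $\mu_c\circ G(\mathrm{id}_c,f^{op})=\mu_{c'}\circ G(f,\mathrm{id}_{c'})$ on $G(c,c')$ for all $f:c\to c'$. Cowedges over $G$ form a category, and $\mathrm{coend}(G)$ is its initial object. For a functor $F:\mathcal D\to\mathcal C_0\subset\mathcal C$ one puts $\mathrm{coend}(F):=\mathrm{coend}(\mathrm{Cohom}_{\mathcal C}\circ(F\times F^{op}))$. $F\otimes M$ denotes the functor $X\mapsto F(X)\otimes M$. *)

theory Defs
  imports Main
begin

section \<open>Categories, functors, natural transformations\<close>

record ('o, 'm) cat =
  Obj :: "'o set"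
  Arr :: "'m set"
  Dom :: "'m \<Rightarrow> 'o"
  Cod :: "'m \<Rightarrow> 'o"
  Ident :: "'o \<Rightarrow> 'm" ("\<i>\<index>")
  Comp :: "'m \<Rightarrow> 'm \<Rightarrow> 'm" (infixr "\<cdot>\<index>" 75)

text \<open>\<open>g \<cdot>\<^bsub>C\<^esub> f\<close> is "first \<open>f\<close>, then \<open>g\<close>"; it is only constrained on composable arrows.\<close>

definition hom :: "('o, 'm, 'z) cat_scheme \<Rightarrow> 'o \<Rightarrow> 'o \<Rightarrow> 'm set" where
  "hom C X Y = {f \<in> Arr C. Dom C f = X \<and> Cod C f = Y}"

locale category =
  fixes C :: "('o, 'm, 'z) cat_scheme" (structure)
  assumes Dom_in: "f \<in> Arr C \<Longrightarrow> Dom C f \<in> Obj C"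
    and Cod_in: "f \<in> Arr C \<Longrightarrow> Cod C f \<in> Obj C"
    and Ident_in: "X \<in> Obj C \<Longrightarrow> \<i> X \<in> hom C X X"
    and Comp_in: "\<lbrakk>f \<in> hom C X Y; g \<in> hom C Y Z\<rbrakk> \<Longrightarrow> g \<cdot> f \<in> hom C X Z"
    and Comp_Ident: "f \<in> hom C X Y \<Longrightarrow> f \<cdot> \<i> X = f"
    and Ident_Comp: "f \<in> hom C X Y \<Longrightarrow> \<i> Y \<cdot> f = f"
    and Comp_assoc:
      "\<lbrakk>f \<in> hom C W X; g \<in> hom C X Y; h \<in> hom C Y Z\<rbrakk> \<Longrightarrow> (h \<cdot> g) \<cdot> f = h \<cdot> (g \<cdot> f)"

definition is_inverse :: "('o, 'm, 'z) cat_scheme \<Rightarrow> 'm \<Rightarrow> 'm \<Rightarrow> bool" where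
  "is_inverse C f g \<longleftrightarrow>
     f \<in> hom C (Dom C f) (Cod C f) \<and> g \<in> hom C (Cod C f) (Dom C f) \<and>
     g \<cdot>\<^bsub>C\<^esub> f = \<i>\<^bsub>C\<^esub> (Dom C f) \<and> f \<cdot>\<^bsub>C\<^esub> g = \<i>\<^bsub>C\<^esub> (Cod C f)"

definition is_iso :: "('o, 'm, 'z) cat_scheme \<Rightarrow> 'm \<Rightarrow> bool" where
  "is_iso C f \<longleftrightarrow> (\<exists>g. is_inverse C f g)"

definition inverse_arr :: "('o, 'm, 'z) cat_scheme \<Rightarrow> 'm \<Rightarrow> 'm" where
  "inverse_arr C f = (THE g. is_inverse C f g)"

locale subcategory = S: category S + C: category C
  for S :: "('o, 'm, 'y) cat_scheme" and C :: "('o, 'm, 'z) cat_scheme" +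
  assumes Obj_subset: "Obj S \<subseteq> Obj C"
    and Arr_subset: "Arr S \<subseteq> Arr C"
    and Dom_eq: "f \<in> Arr S \<Longrightarrow> Dom S f = Dom C f"
    and Cod_eq: "f \<in> Arr S \<Longrightarrow> Cod S f = Cod C f"
    and Ident_eq: "X \<in> Obj S \<Longrightarrow> \<i>\<^bsub>S\<^esub> X = \<i>\<^bsub>C\<^esub> X"
    and Comp_eq: "\<lbrakk>f \<in> hom S X Y; g \<in> hom S Y Z\<rbrakk> \<Longrightarrow> g \<cdot>\<^bsub>S\<^esub> f = g \<cdot>\<^bsub>C\<^esub> f"

definition op_cat :: "('o, 'm, 'z) cat_scheme \<Rightarrow> ('o, 'm) cat" where
  "op_cat C = \<lparr>Obj = Obj C, Arr = Arr C, Dom = Cod C, Cod = Dom C, Ident = Ident C,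
     Comp = (\<lambda>g f. f \<cdot>\<^bsub>C\<^esub> g)\<rparr>"

definition prod_cat ::
  "('o, 'm, 'y) cat_scheme \<Rightarrow> ('p, 'n, 'z) cat_scheme \<Rightarrow> ('o \<times> 'p, 'm \<times> 'n) cat" where
  "prod_cat A B = \<lparr>Obj = Obj A \<times> Obj B, Arr = Arr A \<times> Arr B,
     Dom = map_prod (Dom A) (Dom B), Cod = map_prod (Cod A) (Cod B),
     Ident = map_prod (Ident A) (Ident B),
     Comp = (\<lambda>(g, g') (f, f'). (g \<cdot>\<^bsub>A\<^esub> f, g' \<cdot>\<^bsub>B\<^esub> f'))\<rparr>"

record ('o, 'm, 'p, 'n) func =
  omap :: "'o \<Rightarrow> 'p"
  amap :: "'m \<Rightarrow> 'n"

locale cat_functor = A: category A + B: category B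
  for A :: "('o, 'm, 'y) cat_scheme" and B :: "('p, 'n, 'z) cat_scheme"
    and F :: "('o, 'm, 'p, 'n) func" +
  assumes omap_in: "X \<in> Obj A \<Longrightarrow> omap F X \<in> Obj B"
    and amap_in: "f \<in> hom A X Y \<Longrightarrow> amap F f \<in> hom B (omap F X) (omap F Y)"
    and amap_Ident: "X \<in> Obj A \<Longrightarrow> amap F (\<i>\<^bsub>A\<^esub> X) = \<i>\<^bsub>B\<^esub> (omap F X)"
    and amap_Comp: "\<lbrakk>f \<in> hom A X Y; g \<in> hom A Y Z\<rbrakk> \<Longrightarrow>
      amap F (g \<cdot>\<^bsub>A\<^esub> f) = amap F g \<cdot>\<^bsub>B\<^esub> amap F f"

definition func_comp ::
  "('p, 'n, 'q, 'l) func \<Rightarrow> ('o, 'm, 'p, 'n) func \<Rightarrow> ('o, 'm, 'q, 'l) func" where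
  "func_comp G F = \<lparr>omap = omap G \<circ> omap F, amap = amap G \<circ> amap F\<rparr>"

text \<open>Opposite categories share objects and arrows with the original category, so the same data
  \<open>func_prod F F\<close> also describe the functor \<open>F \<times> F\<^sup>o\<^sup>p\<close>.\<close>

definition func_prod ::
  "('o, 'm, 'p, 'n) func \<Rightarrow> ('o1, 'm1, 'p1, 'n1) func \<Rightarrow>
   ('o \<times> 'o1, 'm \<times> 'm1, 'p \<times> 'p1, 'n \<times> 'n1) func" where
  "func_prod F G =
     \<lparr>omap = map_prod (omap F) (omap G), amap = map_prod (amap F) (amap G)\<rparr>"

locale nat_trans = F: cat_functor A B F + G: cat_functor A B G
  for A :: "('o, 'm, 'y) cat_scheme" and B :: "('p, 'n, 'z) cat_scheme"
    and F G :: "('o, 'm, 'p, 'n) func" and \<tau> :: "'o \<Rightarrow> 'n" +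
  assumes component_in: "X \<in> Obj A \<Longrightarrow> \<tau> X \<in> hom B (omap F X) (omap G X)"
    and naturality: "f \<in> hom A X Y \<Longrightarrow> amap G f \<cdot>\<^bsub>B\<^esub> \<tau> X = \<tau> Y \<cdot>\<^bsub>B\<^esub> amap F f"

section \<open>Monoidal categories, coalgebras, comodules\<close>

record ('o, 'm) moncat = "('o, 'm) cat" +
  tensor_obj :: "'o \<Rightarrow> 'o \<Rightarrow> 'o" (infixr "\<otimes>\<index>" 80)
  tensor_arr :: "'m \<Rightarrow> 'm \<Rightarrow> 'm" (infixr "\<otimes>\<^sub>m\<index>" 80)
  unit :: 'o ("\<one>\<index>")
  assoc :: "'o \<Rightarrow> 'o \<Rightarrow> 'o \<Rightarrow> 'm" ("\<a>\<index>")
  lunit :: "'o \<Rightarrow> 'm" ("\<l>\<index>")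
  runit :: "'o \<Rightarrow> 'm" ("\<r>\<index>")

locale monoidal_category = category C
  for C :: "('o, 'm, 'z) moncat_scheme" (structure) +
  assumes tensor_obj_in: "\<lbrakk>X \<in> Obj C; Y \<in> Obj C\<rbrakk> \<Longrightarrow> X \<otimes> Y \<in> Obj C"
    and tensor_arr_in: "\<lbrakk>f \<in> hom C X X'; g \<in> hom C Y Y'\<rbrakk> \<Longrightarrow>
      f \<otimes>\<^sub>m g \<in> hom C (X \<otimes> Y) (X' \<otimes> Y')"
    and tensor_Ident: "\<lbrakk>X \<in> Obj C; Y \<in> Obj C\<rbrakk> \<Longrightarrow> \<i> X \<otimes>\<^sub>m \<i> Y = \<i> (X \<otimes> Y)"
    and tensor_Comp: "\<lbrakk>f \<in> hom C X X'; f' \<in> hom C X' X''; g \<in> hom C Y Y'; g' \<in> hom C Y' Y''\<rbrakk> \<Longrightarrow>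
      (f' \<cdot> f) \<otimes>\<^sub>m (g' \<cdot> g) = (f' \<otimes>\<^sub>m g') \<cdot> (f \<otimes>\<^sub>m g)"
    and unit_in: "\<one> \<in> Obj C"
    and assoc_in: "\<lbrakk>X \<in> Obj C; Y \<in> Obj C; Z \<in> Obj C\<rbrakk> \<Longrightarrow>
      \<a> X Y Z \<in> hom C ((X \<otimes> Y) \<otimes> Z) (X \<otimes> (Y \<otimes> Z))"
    and assoc_iso: "\<lbrakk>X \<in> Obj C; Y \<in> Obj C; Z \<in> Obj C\<rbrakk> \<Longrightarrow> is_iso C (\<a> X Y Z)"
    and assoc_natural: "\<lbrakk>f \<in> hom C X X'; g \<in> hom C Y Y'; h \<in> hom C Z Z'\<rbrakk> \<Longrightarrow>
      \<a> X' Y' Z' \<cdot> ((f \<otimes>\<^sub>m g) \<otimes>\<^sub>m h) = (f \<otimes>\<^sub>m (g \<otimes>\<^sub>m h)) \<cdot> \<a> X Y Z"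
    and lunit_in: "X \<in> Obj C \<Longrightarrow> \<l> X \<in> hom C (\<one> \<otimes> X) X"
    and lunit_iso: "X \<in> Obj C \<Longrightarrow> is_iso C (\<l> X)"
    and lunit_natural: "f \<in> hom C X Y \<Longrightarrow> \<l> Y \<cdot> (\<i> \<one> \<otimes>\<^sub>m f) = f \<cdot> \<l> X"
    and runit_in: "X \<in> Obj C \<Longrightarrow> \<r> X \<in> hom C (X \<otimes> \<one>) X"
    and runit_iso: "X \<in> Obj C \<Longrightarrow> is_iso C (\<r> X)"
    and runit_natural: "f \<in> hom C X Y \<Longrightarrow> \<r> Y \<cdot> (f \<otimes>\<^sub>m \<i> \<one>) = f \<cdot> \<r> X"
    and pentagon: "\<lbrakk>W \<in> Obj C; X \<in> Obj C; Y \<in> Obj C; Z \<in> Obj C\<rbrakk> \<Longrightarrow>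
      (\<i> W \<otimes>\<^sub>m \<a> X Y Z) \<cdot> \<a> W (X \<otimes> Y) Z \<cdot> (\<a> W X Y \<otimes>\<^sub>m \<i> Z) =
      \<a> W X (Y \<otimes> Z) \<cdot> \<a> (W \<otimes> X) Y Z"
    and triangle: "\<lbrakk>X \<in> Obj C; Y \<in> Obj C\<rbrakk> \<Longrightarrow>
      (\<i> X \<otimes>\<^sub>m \<l> Y) \<cdot> \<a> X \<one> Y = \<r> X \<otimes>\<^sub>m \<i> Y"

locale coalgebra = monoidal_category C
  for C :: "('o, 'm, 'z) moncat_scheme" (structure) and E :: 'o and \<Delta> \<epsilon> :: 'm +
  assumes coalg_obj: "E \<in> Obj C"
    and comult_in: "\<Delta> \<in> hom C E (E \<otimes> E)"
    and counit_in: "\<epsilon> \<in> hom C E \<one>"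
    and coassoc: "\<a> E E E \<cdot> (\<Delta> \<otimes>\<^sub>m \<i> E) \<cdot> \<Delta> = (\<i> E \<otimes>\<^sub>m \<Delta>) \<cdot> \<Delta>"
    and left_counit: "\<l> E \<cdot> (\<epsilon> \<otimes>\<^sub>m \<i> E) \<cdot> \<Delta> = \<i> E"
    and right_counit: "\<r> E \<cdot> (\<i> E \<otimes>\<^sub>m \<epsilon>) \<cdot> \<Delta> = \<i> E"

locale right_comodule = coalgebra C E \<Delta> \<epsilon>
  for C :: "('o, 'm, 'z) moncat_scheme" (structure) and E :: 'o and \<Delta> \<epsilon> :: 'm
    and N :: 'o and \<delta> :: 'm +
  assumes comod_obj: "N \<in> Obj C"
    and coaction_in: "\<delta> \<in> hom C N (N \<otimes> E)"
    and coaction_coassoc: "\<a> N E E \<cdot> (\<delta> \<otimes>\<^sub>m \<i> E) \<cdot> \<delta> = (\<i> N \<otimes>\<^sub>m \<Delta>) \<cdot> \<delta>"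
    and coaction_counit: "\<r> N \<cdot> (\<i> N \<otimes>\<^sub>m \<epsilon>) \<cdot> \<delta> = \<i> N"

locale comodule_morphism =
  N: right_comodule C E \<Delta> \<epsilon> N \<delta> + N': right_comodule C E \<Delta> \<epsilon> N' \<delta>'
  for C :: "('o, 'm, 'z) moncat_scheme" (structure) and E :: 'o and \<Delta> \<epsilon> :: 'm
    and N :: 'o and \<delta> :: 'm and N' :: 'o and \<delta>' :: 'm and f :: 'm +
  assumes morphism_in: "f \<in> hom C N N'"
    and colinear: "\<delta>' \<cdot> f = (f \<otimes>\<^sub>m \<i> E) \<cdot> \<delta>"

definition func_tensor ::
  "('p, 'n, 'z) moncat_scheme \<Rightarrow> ('o, 'm, 'p, 'n) func \<Rightarrow> 'p \<Rightarrow> ('o, 'm, 'p, 'n) func" where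
  "func_tensor C F M =
     \<lparr>omap = (\<lambda>X. omap F X \<otimes>\<^bsub>C\<^esub> M), amap = (\<lambda>f. amap F f \<otimes>\<^sub>m\<^bsub>C\<^esub> \<i>\<^bsub>C\<^esub> M)\<rparr>"

section \<open>Cohomomorphism objects\<close>

definition is_cohom :: "('o, 'm, 'z) moncat_scheme \<Rightarrow> 'o \<Rightarrow> 'o \<Rightarrow> 'o \<Rightarrow> 'm \<Rightarrow> bool" where
  "is_cohom C X Y H c \<longleftrightarrow>
     H \<in> Obj C \<and> c \<in> hom C X (Y \<otimes>\<^bsub>C\<^esub> H) \<and>
     (\<forall>Z \<in> Obj C. \<forall>\<phi> \<in> hom C X (Y \<otimes>\<^bsub>C\<^esub> Z).
        \<exists>!u. u \<in> hom C H Z \<and> (\<i>\<^bsub>C\<^esub> Y \<otimes>\<^sub>m\<^bsub>C\<^esub> u) \<cdot>\<^bsub>C\<^esub> c = \<phi>)"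

definition right_coclosed ::
  "('o, 'm, 'z) moncat_scheme \<Rightarrow> ('o, 'm, 'y) cat_scheme \<Rightarrow> bool" where
  "right_coclosed C S \<longleftrightarrow> (\<forall>X \<in> Obj S. \<forall>Y \<in> Obj S. \<exists>H c. is_cohom C X Y H c)"

text \<open>A choice \<open>h X Y\<close>, \<open>ev X Y\<close> of the objects \<open>cohom(X, Y)\<close> and morphisms
  \<open>coev\<^sub>X\<^sub>,\<^sub>Y\<close>, which are determined only up to isomorphism.\<close>

definition cohom_choice ::
  "('o, 'm, 'z) moncat_scheme \<Rightarrow> ('o, 'm, 'y) cat_scheme \<Rightarrow>
   ('o \<Rightarrow> 'o \<Rightarrow> 'o) \<Rightarrow> ('o \<Rightarrow> 'o \<Rightarrow> 'm) \<Rightarrow> bool" where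
  "cohom_choice C S h ev \<longleftrightarrow> (\<forall>X \<in> Obj S. \<forall>Y \<in> Obj S. is_cohom C X Y (h X Y) (ev X Y))"

text \<open>The object \<open>Z\<close> is an argument because it is not determined by
  \<open>\<phi> : X \<rightarrow> Y \<otimes> Z\<close>.\<close>

definition coact ::
  "('o, 'm, 'z) moncat_scheme \<Rightarrow> ('o \<Rightarrow> 'o \<Rightarrow> 'o) \<Rightarrow> ('o \<Rightarrow> 'o \<Rightarrow> 'm) \<Rightarrow>
   'o \<Rightarrow> 'o \<Rightarrow> 'o \<Rightarrow> 'm \<Rightarrow> 'm" where
  "coact C h ev X Y Z \<phi> =
     (THE u. u \<in> hom C (h X Y) Z \<and> (\<i>\<^bsub>C\<^esub> Y \<otimes>\<^sub>m\<^bsub>C\<^esub> u) \<cdot>\<^bsub>C\<^esub> ev X Y = \<phi>)"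

definition cohom_left ::
  "('o, 'm, 'z) moncat_scheme \<Rightarrow> ('o \<Rightarrow> 'o \<Rightarrow> 'o) \<Rightarrow> ('o \<Rightarrow> 'o \<Rightarrow> 'm) \<Rightarrow> 'm \<Rightarrow> 'o \<Rightarrow> 'm"
where
  "cohom_left C h ev f Y =
     coact C h ev (Dom C f) Y (h (Cod C f) Y) (ev (Cod C f) Y \<cdot>\<^bsub>C\<^esub> f)"

definition cohom_right ::
  "('o, 'm, 'z) moncat_scheme \<Rightarrow> ('o \<Rightarrow> 'o \<Rightarrow> 'o) \<Rightarrow> ('o \<Rightarrow> 'o \<Rightarrow> 'm) \<Rightarrow> 'o \<Rightarrow> 'm \<Rightarrow> 'm"
where
  "cohom_right C h ev X g =
     coact C h ev X (Cod C g) (h X (Dom C g))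
       ((g \<otimes>\<^sub>m\<^bsub>C\<^esub> \<i>\<^bsub>C\<^esub> (h X (Dom C g))) \<cdot>\<^bsub>C\<^esub> ev X (Dom C g))"

text \<open>For \<open>f : X \<rightarrow> X'\<close> and \<open>g : Y \<rightarrow> Y'\<close>, the arrow part is
  \<open>cohom(f, g\<^sup>o\<^sup>p) = cohom(f, id\<^sub>Y) \<circ> cohom(id\<^sub>X, g\<^sup>o\<^sup>p) : cohom(X, Y') \<rightarrow> cohom(X', Y)\<close>.\<close>

definition Cohom ::
  "('o, 'm, 'z) moncat_scheme \<Rightarrow> ('o \<Rightarrow> 'o \<Rightarrow> 'o) \<Rightarrow> ('o \<Rightarrow> 'o \<Rightarrow> 'm) \<Rightarrow>
   ('o \<times> 'o, 'm \<times> 'm, 'o, 'm) func" where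
  "Cohom C h ev =
     \<lparr>omap = (\<lambda>(X, Y). h X Y),
      amap = (\<lambda>(f, g). cohom_left C h ev f (Dom C g) \<cdot>\<^bsub>C\<^esub> cohom_right C h ev (Dom C f) g)\<rparr>"

locale right_coclosed_subcategory = monoidal_category C + subcategory S C
  for C :: "('o, 'm, 'z) moncat_scheme" (structure) and S :: "('o, 'm, 'y) cat_scheme"
    and h :: "'o \<Rightarrow> 'o \<Rightarrow> 'o" and ev :: "'o \<Rightarrow> 'o \<Rightarrow> 'm" +
  assumes choice: "cohom_choice C S h ev"
begin

lemma hom_SC: "f \<in> hom S X Y \<Longrightarrow> f \<in> hom C X Y"
  using Arr_subset Dom_eq Cod_eq by (auto simp: hom_def)

lemma hom_S_Obj: "f \<in> hom S X Y \<Longrightarrow> X \<in> Obj S \<and> Y \<in> Obj S"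
  using S.Dom_in S.Cod_in by (auto simp: hom_def)

lemma cohomD:
  assumes "X \<in> Obj S" "Y \<in> Obj S"
  shows "h X Y \<in> Obj C" "ev X Y \<in> hom C X (Y \<otimes> h X Y)"
    "\<And>Z \<phi>. Z \<in> Obj C \<Longrightarrow> \<phi> \<in> hom C X (Y \<otimes> Z) \<Longrightarrow>
       \<exists>!u. u \<in> hom C (h X Y) Z \<and> (\<i> Y \<otimes>\<^sub>m u) \<cdot> ev X Y = \<phi>"
  using choice assms by (auto simp: cohom_choice_def is_cohom_def)

lemma coact:
  assumes "X \<in> Obj S" "Y \<in> Obj S" "Z \<in> Obj C" "\<phi> \<in> hom C X (Y \<otimes> Z)"
  shows "coact C h ev X Y Z \<phi> \<in> hom C (h X Y) Z"
    "(\<i> Y \<otimes>\<^sub>m coact C h ev X Y Z \<phi>) \<cdot> ev X Y = \<phi>"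
  using theI'[OF cohomD(3)[OF assms]] unfolding coact_def by auto

lemma cohom_ext:
  assumes "X \<in> Obj S" "Y \<in> Obj S"
    "u \<in> hom C (h X Y) Z" "v \<in> hom C (h X Y) Z"
    "(\<i> Y \<otimes>\<^sub>m u) \<cdot> ev X Y = (\<i> Y \<otimes>\<^sub>m v) \<cdot> ev X Y"
  shows "u = v"
proof -
  have Z: "Z \<in> Obj C" using assms(3) Cod_in by (auto simp: hom_def)
  have "Y \<in> Obj C" using assms(2) Obj_subset by auto
  then have "(\<i> Y \<otimes>\<^sub>m u) \<cdot> ev X Y \<in> hom C X (Y \<otimes> Z)"
    by (intro Comp_in[OF cohomD(2)[OF assms(1,2)]] tensor_arr_in Ident_in assms(3))
  from cohomD(3)[OF assms(1,2) Z this] show ?thesis using assms(3,4) assms(5)[symmetric] by (elim ex1E) auto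
qed

lemma slide:
  assumes "g \<in> hom C Y Y'" "k \<in> hom C H H'"
  shows "(\<i> Y' \<otimes>\<^sub>m k) \<cdot> (g \<otimes>\<^sub>m \<i> H) = (g \<otimes>\<^sub>m \<i> H') \<cdot> (\<i> Y \<otimes>\<^sub>m k)"
proof -
  have o: "Y \<in> Obj C" "Y' \<in> Obj C" "H \<in> Obj C" "H' \<in> Obj C"
    using assms Dom_in Cod_in by (auto simp: hom_def)
  show ?thesis
    using tensor_Comp[OF assms(1) Ident_in[OF o(2)] Ident_in[OF o(3)] assms(2)]
      tensor_Comp[OF Ident_in[OF o(1)] assms(1) assms(2) Ident_in[OF o(4)]]
    by (simp add: Comp_Ident[OF assms(1)] Comp_Ident[OF assms(2)]
        Ident_Comp[OF assms(1)] Ident_Comp[OF assms(2)])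
qed

lemma tensor_Ident_Comp:
  assumes "Y \<in> Obj C" "k \<in> hom C H H'" "k' \<in> hom C H' H''"
  shows "\<i> Y \<otimes>\<^sub>m (k' \<cdot> k) = (\<i> Y \<otimes>\<^sub>m k') \<cdot> (\<i> Y \<otimes>\<^sub>m k)"
  using tensor_Comp[OF Ident_in[OF assms(1)] Ident_in[OF assms(1)] assms(2,3)]
  by (simp add: Comp_Ident[OF Ident_in[OF assms(1)]])

lemma Cohom_arr:
  assumes f: "f \<in> hom S X X'" and g: "g \<in> hom S Y Y'"
  shows "amap (Cohom C h ev) (f, g) \<in> hom C (h X Y') (h X' Y)" (is "?k \<in> _")
    and "(\<i> Y' \<otimes>\<^sub>m amap (Cohom C h ev) (f, g)) \<cdot> ev X Y' =
      (g \<otimes>\<^sub>m \<i> (h X' Y)) \<cdot> ev X' Y \<cdot> f"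
proof -
  note fC = hom_SC[OF f] and gC = hom_SC[OF g]
  have o: "X \<in> Obj S" "X' \<in> Obj S" "Y \<in> Obj S" "Y' \<in> Obj S"
    using hom_S_Obj f g by auto
  then have oC: "X \<in> Obj C" "X' \<in> Obj C" "Y \<in> Obj C" "Y' \<in> Obj C"
    using Obj_subset by auto
  have D: "Dom C f = X" "Cod C f = X'" "Dom C g = Y" "Cod C g = Y'"
    using fC gC by (auto simp: hom_def)
  let ?l = "cohom_left C h ev f Y" and ?r = "cohom_right C h ev X g"
  note H = cohomD(1)[OF o(1,3)] cohomD(1)[OF o(2,3)] cohomD(1)[OF o(1,4)]
  have gi: "g \<otimes>\<^sub>m \<i> (h X Y) \<in> hom C (Y \<otimes> h X Y) (Y' \<otimes> h X Y)"
    "g \<otimes>\<^sub>m \<i> (h X' Y) \<in> hom C (Y \<otimes> h X' Y) (Y' \<otimes> h X' Y)"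
    by (intro tensor_arr_in gC Ident_in H)+
  have evs: "ev X Y \<in> hom C X (Y \<otimes> h X Y)" "ev X' Y \<in> hom C X' (Y \<otimes> h X' Y)"
    "ev X Y' \<in> hom C X (Y' \<otimes> h X Y')"
    using cohomD(2) o by auto
  have l: "?l \<in> hom C (h X Y) (h X' Y)" "(\<i> Y \<otimes>\<^sub>m ?l) \<cdot> ev X Y = ev X' Y \<cdot> f"
    unfolding cohom_left_def D
    using coact[OF o(1,3) H(2) Comp_in[OF fC evs(2)]] by auto
  have r: "?r \<in> hom C (h X Y') (h X Y)"
    "(\<i> Y' \<otimes>\<^sub>m ?r) \<cdot> ev X Y' = (g \<otimes>\<^sub>m \<i> (h X Y)) \<cdot> ev X Y"
    unfolding cohom_right_def D
    using coact[OF o(1,4) H(1) Comp_in[OF evs(1) gi(1)]] by auto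
  have k: "?k = ?l \<cdot> ?r" by (simp add: Cohom_def D)
  show "?k \<in> hom C (h X Y') (h X' Y)" unfolding k by (rule Comp_in[OF r(1) l(1)])
  have il: "\<i> Y \<otimes>\<^sub>m ?l \<in> hom C (Y \<otimes> h X Y) (Y \<otimes> h X' Y)"
    "\<i> Y' \<otimes>\<^sub>m ?l \<in> hom C (Y' \<otimes> h X Y) (Y' \<otimes> h X' Y)"
    "\<i> Y' \<otimes>\<^sub>m ?r \<in> hom C (Y' \<otimes> h X Y') (Y' \<otimes> h X Y)"
    by (intro tensor_arr_in Ident_in oC l(1) r(1))+
  have "\<i> Y' \<otimes>\<^sub>m ?k = (\<i> Y' \<otimes>\<^sub>m ?l) \<cdot> (\<i> Y' \<otimes>\<^sub>m ?r)"
    unfolding k by (rule tensor_Ident_Comp[OF oC(4) r(1) l(1)])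
  then have "(\<i> Y' \<otimes>\<^sub>m ?k) \<cdot> ev X Y' = (\<i> Y' \<otimes>\<^sub>m ?l) \<cdot> (\<i> Y' \<otimes>\<^sub>m ?r) \<cdot> ev X Y'"
    using Comp_assoc[OF evs(3) il(3) il(2)] by simp
  also have "\<dots> = ((\<i> Y' \<otimes>\<^sub>m ?l) \<cdot> (g \<otimes>\<^sub>m \<i> (h X Y))) \<cdot> ev X Y"
    using r(2) Comp_assoc[OF evs(1) gi(1) il(2)] by simp
  also have "\<dots> = (g \<otimes>\<^sub>m \<i> (h X' Y)) \<cdot> ev X' Y \<cdot> f"
    using slide[OF gC l(1)] Comp_assoc[OF evs(1) il(1) gi(2)] l(2) by simp
  finally show "(\<i> Y' \<otimes>\<^sub>m ?k) \<cdot> ev X Y' = (g \<otimes>\<^sub>m \<i> (h X' Y)) \<cdot> ev X' Y \<cdot> f" .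
qed

lemma Cohom_Ident:
  assumes "X \<in> Obj S" "Y \<in> Obj S"
  shows "amap (Cohom C h ev) (\<i>\<^bsub>S\<^esub> X, \<i>\<^bsub>S\<^esub> Y) = \<i> (h X Y)"
proof -
  have oC: "X \<in> Obj C" "Y \<in> Obj C" using assms Obj_subset by auto
  note ev = cohomD(1,2)[OF assms]
  note A = Cohom_arr[OF S.Ident_in[OF assms(1)] S.Ident_in[OF assms(2)]]
  show ?thesis
  proof (rule cohom_ext[OF assms A(1) Ident_in[OF ev(1)]])
    show "(\<i> Y \<otimes>\<^sub>m amap (Cohom C h ev) (\<i>\<^bsub>S\<^esub> X, \<i>\<^bsub>S\<^esub> Y)) \<cdot> ev X Y =
      (\<i> Y \<otimes>\<^sub>m \<i> (h X Y)) \<cdot> ev X Y"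
      unfolding A(2) by (simp add: Ident_eq assms Comp_Ident[OF ev(2)])
  qed
qed

lemma Cohom_Comp:
  assumes f: "f \<in> hom S X X'" "f' \<in> hom S X' X''" and g: "g \<in> hom S Y Y'" "g' \<in> hom S Y' Y''"
  shows "amap (Cohom C h ev) (f' \<cdot>\<^bsub>S\<^esub> f, g' \<cdot>\<^bsub>S\<^esub> g) =
    amap (Cohom C h ev) (f', g) \<cdot> amap (Cohom C h ev) (f, g')"
proof -
  note fC = f[THEN hom_SC] and gC = g[THEN hom_SC]
  have o: "X \<in> Obj S" "X' \<in> Obj S" "X'' \<in> Obj S" "Y \<in> Obj S" "Y' \<in> Obj S" "Y'' \<in> Obj S"
    using hom_S_Obj f g by auto
  then have oC: "Y \<in> Obj C" "Y' \<in> Obj C" "Y'' \<in> Obj C" using Obj_subset by auto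
  note K = Cohom_arr[OF S.Comp_in[OF f] S.Comp_in[OF g]]
  note K1 = Cohom_arr[OF f(1) g(2)] and K2 = Cohom_arr[OF f(2) g(1)]
  let ?k1 = "amap (Cohom C h ev) (f, g')" and ?k2 = "amap (Cohom C h ev) (f', g)"
  let ?G' = "g' \<otimes>\<^sub>m \<i> (h X' Y')" and ?G'' = "g' \<otimes>\<^sub>m \<i> (h X'' Y)" and ?G = "g \<otimes>\<^sub>m \<i> (h X'' Y)"
  have H: "h X' Y' \<in> Obj C" "h X'' Y \<in> Obj C" using cohomD(1) o by auto
  have G: "?G' \<in> hom C (Y' \<otimes> h X' Y') (Y'' \<otimes> h X' Y')"
    "?G'' \<in> hom C (Y' \<otimes> h X'' Y) (Y'' \<otimes> h X'' Y)" "?G \<in> hom C (Y \<otimes> h X'' Y) (Y' \<otimes> h X'' Y)"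
    by (intro tensor_arr_in gC Ident_in H)+
  have evs: "ev X Y'' \<in> hom C X (Y'' \<otimes> h X Y'')" "ev X' Y' \<in> hom C X' (Y' \<otimes> h X' Y')"
    "ev X'' Y \<in> hom C X'' (Y \<otimes> h X'' Y)"
    using cohomD(2) o by auto
  have I: "\<i> Y'' \<otimes>\<^sub>m ?k1 \<in> hom C (Y'' \<otimes> h X Y'') (Y'' \<otimes> h X' Y')"
    "\<i> Y'' \<otimes>\<^sub>m ?k2 \<in> hom C (Y'' \<otimes> h X' Y') (Y'' \<otimes> h X'' Y)"
    "\<i> Y' \<otimes>\<^sub>m ?k2 \<in> hom C (Y' \<otimes> h X' Y') (Y' \<otimes> h X'' Y)"
    by (intro tensor_arr_in Ident_in oC K1(1) K2(1))+
  show ?thesis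
  proof (rule cohom_ext[OF o(1,6) K(1) Comp_in[OF K1(1) K2(1)]])
    have "(\<i> Y'' \<otimes>\<^sub>m (?k2 \<cdot> ?k1)) \<cdot> ev X Y'' = ((\<i> Y'' \<otimes>\<^sub>m ?k2) \<cdot> (\<i> Y'' \<otimes>\<^sub>m ?k1)) \<cdot> ev X Y''"
      by (simp add: tensor_Ident_Comp[OF oC(3) K1(1) K2(1)])
    also have "\<dots> = (\<i> Y'' \<otimes>\<^sub>m ?k2) \<cdot> ?G' \<cdot> ev X' Y' \<cdot> f"
      using Comp_assoc[OF evs(1) I(1,2)] K1(2) by simp
    also have "\<dots> = ((\<i> Y'' \<otimes>\<^sub>m ?k2) \<cdot> ?G') \<cdot> ev X' Y' \<cdot> f"
      using Comp_assoc[OF Comp_in[OF fC(1) evs(2)] G(1) I(2)] by simp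
    also have "\<dots> = ?G'' \<cdot> (\<i> Y' \<otimes>\<^sub>m ?k2) \<cdot> ev X' Y' \<cdot> f"
      using slide[OF gC(2) K2(1)] Comp_assoc[OF Comp_in[OF fC(1) evs(2)] I(3) G(2)] by simp
    also have "\<dots> = ?G'' \<cdot> (?G \<cdot> ev X'' Y \<cdot> f') \<cdot> f"
      using Comp_assoc[OF fC(1) evs(2) I(3)] K2(2) by simp
    also have "\<dots> = (?G'' \<cdot> ?G) \<cdot> ev X'' Y \<cdot> f' \<cdot> f"
      using Comp_assoc[OF fC(1) Comp_in[OF fC(2) evs(3)] G(3)]
        Comp_assoc[OF fC evs(3)]
        Comp_assoc[OF Comp_in[OF Comp_in[OF fC] evs(3)] G(3) G(2)] by simp
    also have "?G'' \<cdot> ?G = (g' \<cdot> g) \<otimes>\<^sub>m \<i> (h X'' Y)"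
      using tensor_Comp[OF gC Ident_in[OF H(2)] Ident_in[OF H(2)]] Comp_Ident Ident_in[OF H(2)]
      by simp
    finally show "(\<i> Y'' \<otimes>\<^sub>m amap (Cohom C h ev) (f' \<cdot>\<^bsub>S\<^esub> f, g' \<cdot>\<^bsub>S\<^esub> g)) \<cdot> ev X Y'' =
        (\<i> Y'' \<otimes>\<^sub>m (?k2 \<cdot> ?k1)) \<cdot> ev X Y''"
      using K(2) Comp_eq[OF f] Comp_eq[OF g] by simp
  qed
qed

end

lemma category_op_prod:
  assumes "category A" "category B"
  shows "category (prod_cat A (op_cat B))"
proof -
  interpret A: category A by fact
  interpret B: category B by fact
  have hom_po: "p \<in> hom (prod_cat A (op_cat B)) P Q \<longleftrightarrow>
    fst p \<in> hom A (fst P) (fst Q) \<and> snd p \<in> hom B (snd Q) (snd P)" for p P Q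
    by (cases p, cases P, cases Q) (auto simp: hom_def prod_cat_def op_cat_def)
  have sel: "Ident (prod_cat A (op_cat B)) P = (\<i>\<^bsub>A\<^esub> (fst P), \<i>\<^bsub>B\<^esub> (snd P))"
    "q \<cdot>\<^bsub>prod_cat A (op_cat B)\<^esub> p = (fst q \<cdot>\<^bsub>A\<^esub> fst p, snd p \<cdot>\<^bsub>B\<^esub> snd q)" for P p q
    by (cases P; cases p; cases q; simp add: prod_cat_def op_cat_def)+
  show ?thesis
  proof (unfold_locales, unfold hom_po sel, goal_cases)
    case (1 f)
    then show ?case by (auto simp: prod_cat_def op_cat_def A.Dom_in B.Cod_in)
  next
    case (2 f)
    then show ?case by (auto simp: prod_cat_def op_cat_def A.Cod_in B.Dom_in)
  next
    case (3 X)
    then show ?case by (auto simp: prod_cat_def op_cat_def A.Ident_in B.Ident_in)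
  next
    case (4 f X Y g Z)
    then show ?case
      by (auto intro: A.Comp_in B.Comp_in)
  next
    case (5 f X Y)
    then show ?case
      using A.Comp_Ident[of "fst f" "fst X" "fst Y"] B.Ident_Comp[of "snd f" "snd Y" "snd X"]
      by (simp add: prod_eq_iff)
  next
    case (6 f X Y)
    then show ?case
      using A.Ident_Comp[of "fst f" "fst X" "fst Y"] B.Comp_Ident[of "snd f" "snd Y" "snd X"]
      by (simp add: prod_eq_iff)
  next
    case (7 f W X g Y h Z)
    then show ?case
      using A.Comp_assoc[of "fst f" "fst W" "fst X" "fst g" "fst Y" "fst h" "fst Z"]
        B.Comp_assoc[of "snd h" "snd Z" "snd Y" "snd g" "snd X" "snd f" "snd W"] by simp
  qed
qed

lemma (in right_coclosed_subcategory) Cohom_bifunctor: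
  "cat_functor (prod_cat S (op_cat S)) C (Cohom C h ev)"
proof -
  have hom_po: "p \<in> hom (prod_cat S (op_cat S)) P Q \<longleftrightarrow>
    fst p \<in> hom S (fst P) (fst Q) \<and> snd p \<in> hom S (snd Q) (snd P)" for p P Q
    by (cases p, cases P, cases Q) (auto simp: hom_def prod_cat_def op_cat_def)
  have om: "omap (Cohom C h ev) P = h (fst P) (snd P)" for P
    by (cases P) (simp add: Cohom_def)
  interpret P: category "prod_cat S (op_cat S)"
    by (rule category_op_prod) unfold_locales
  show ?thesis
  proof unfold_locales
    fix P assume "P \<in> Obj (prod_cat S (op_cat S))"
    then have P: "fst P \<in> Obj S" "snd P \<in> Obj S" by (auto simp: prod_cat_def op_cat_def)
    show "omap (Cohom C h ev) P \<in> Obj C" using cohomD(1) P by (simp add: om)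
    show "amap (Cohom C h ev) (\<i>\<^bsub>prod_cat S (op_cat S)\<^esub> P) = \<i> (omap (Cohom C h ev) P)"
      using Cohom_Ident P
      by (cases P) (simp add: om prod_cat_def op_cat_def)
  next
    fix p P Q assume "p \<in> hom (prod_cat S (op_cat S)) P Q"
    then show "amap (Cohom C h ev) p \<in> hom C (omap (Cohom C h ev) P) (omap (Cohom C h ev) Q)"
      using Cohom_arr(1)[of "fst p" _ _ "snd p"] by (simp add: hom_po om)
  next
    fix p q P Q R
    assume "p \<in> hom (prod_cat S (op_cat S)) P Q" "q \<in> hom (prod_cat S (op_cat S)) Q R"
    then show "amap (Cohom C h ev) (q \<cdot>\<^bsub>prod_cat S (op_cat S)\<^esub> p) =
      amap (Cohom C h ev) q \<cdot> amap (Cohom C h ev) p"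
      using Cohom_Comp[of "fst p" "fst P" "fst Q" "fst q" "fst R" "snd q" "snd R" "snd Q" "snd p" "snd P"]
      unfolding hom_po by (cases p, cases q) (simp add: prod_cat_def op_cat_def)
  qed
qed

text \<open>Comultiplication and counit of \<open>cohom(X, X)\<close>. The category is not assumed strict, so
  \<open>(coev \<otimes> id) \<circ> coev\<close> is followed by the associator, and \<open>id\<^sub>X\<close> is read as
  \<open>\<r>\<^sub>X\<^sup>-\<^sup>1 : X \<rightarrow> X \<otimes> \<one>\<close>.\<close>

definition cohom_comult ::
  "('o, 'm, 'z) moncat_scheme \<Rightarrow> ('o \<Rightarrow> 'o \<Rightarrow> 'o) \<Rightarrow> ('o \<Rightarrow> 'o \<Rightarrow> 'm) \<Rightarrow> 'o \<Rightarrow> 'm" where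
  "cohom_comult C h ev X =
     coact C h ev X X (h X X \<otimes>\<^bsub>C\<^esub> h X X)
       (\<a>\<^bsub>C\<^esub> X (h X X) (h X X) \<cdot>\<^bsub>C\<^esub>
        (ev X X \<otimes>\<^sub>m\<^bsub>C\<^esub> \<i>\<^bsub>C\<^esub> (h X X)) \<cdot>\<^bsub>C\<^esub> ev X X)"

definition cohom_counit ::
  "('o, 'm, 'z) moncat_scheme \<Rightarrow> ('o \<Rightarrow> 'o \<Rightarrow> 'o) \<Rightarrow> ('o \<Rightarrow> 'o \<Rightarrow> 'm) \<Rightarrow> 'o \<Rightarrow> 'm" where
  "cohom_counit C h ev X = coact C h ev X X \<one>\<^bsub>C\<^esub> (inverse_arr C (\<r>\<^bsub>C\<^esub> X))"

section \<open>Coends\<close>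

text \<open>Here \<open>G : D \<times> D\<^sup>o\<^sup>p \<rightarrow> C\<close>; its second argument is an arrow of \<open>D\<close> read in
  the opposite category.\<close>

definition cowedge ::
  "('d, 'e, 'y) cat_scheme \<Rightarrow> ('o, 'm, 'z) cat_scheme \<Rightarrow> ('d \<times> 'd, 'e \<times> 'e, 'o, 'm) func \<Rightarrow>
   'o \<Rightarrow> ('d \<Rightarrow> 'm) \<Rightarrow> bool" where
  "cowedge D C G d \<mu> \<longleftrightarrow>
     d \<in> Obj C \<and> (\<forall>c \<in> Obj D. \<mu> c \<in> hom C (omap G (c, c)) d) \<and>
     (\<forall>c \<in> Obj D. \<forall>c' \<in> Obj D. \<forall>f \<in> hom D c c'.
        \<mu> c \<cdot>\<^bsub>C\<^esub> amap G (\<i>\<^bsub>D\<^esub> c, f) = \<mu> c' \<cdot>\<^bsub>C\<^esub> amap G (f, \<i>\<^bsub>D\<^esub> c'))"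

definition cowedge_morphism ::
  "('d, 'e, 'y) cat_scheme \<Rightarrow> ('o, 'm, 'z) cat_scheme \<Rightarrow>
   'o \<Rightarrow> ('d \<Rightarrow> 'm) \<Rightarrow> 'o \<Rightarrow> ('d \<Rightarrow> 'm) \<Rightarrow> 'm \<Rightarrow> bool" where
  "cowedge_morphism D C d \<mu> d' \<mu>' u \<longleftrightarrow>
     u \<in> hom C d d' \<and> (\<forall>c \<in> Obj D. u \<cdot>\<^bsub>C\<^esub> \<mu> c = \<mu>' c)"

text \<open>\<open>(E, i)\<close> is initial in the category of cowedges over \<open>G\<close>.\<close>

definition is_coend ::
  "('d, 'e, 'y) cat_scheme \<Rightarrow> ('o, 'm, 'z) cat_scheme \<Rightarrow> ('d \<times> 'd, 'e \<times> 'e, 'o, 'm) func \<Rightarrow>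
   'o \<Rightarrow> ('d \<Rightarrow> 'm) \<Rightarrow> bool" where
  "is_coend D C G E i \<longleftrightarrow>
     cowedge D C G E i \<and>
     (\<forall>d \<mu>. cowedge D C G d \<mu> \<longrightarrow> (\<exists>!u. cowedge_morphism D C E i d \<mu> u))"

definition Cohom_func ::
  "('o, 'm, 'z) moncat_scheme \<Rightarrow> ('o \<Rightarrow> 'o \<Rightarrow> 'o) \<Rightarrow> ('o \<Rightarrow> 'o \<Rightarrow> 'm) \<Rightarrow>
   ('d, 'e, 'o, 'm) func \<Rightarrow> ('d \<times> 'd, 'e \<times> 'e, 'o, 'm) func" where
  "Cohom_func C h ev F = func_comp (Cohom C h ev) (func_prod F F)"

definition coend_coaction ::
  "('o, 'm, 'z) moncat_scheme \<Rightarrow> ('o \<Rightarrow> 'o \<Rightarrow> 'm) \<Rightarrow> ('d, 'e, 'o, 'm) func \<Rightarrow>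
   ('d \<Rightarrow> 'm) \<Rightarrow> 'd \<Rightarrow> 'm" where
  "coend_coaction C ev F i X =
     (\<i>\<^bsub>C\<^esub> (omap F X) \<otimes>\<^sub>m\<^bsub>C\<^esub> i X) \<cdot>\<^bsub>C\<^esub> ev (omap F X) (omap F X)"

end

theory Submission
  imports Defs
begin

text \<open>By the universal property of \<open>cohom(F X, F X)\<close>, a family
  \<open>\<mu>\<^sub>X : cohom(F X, F X) \<rightarrow> M\<close> is the same as a family
  \<open>\<theta>\<^sub>X = (id \<otimes> \<mu>\<^sub>X) \<circ> coev : F X \<rightarrow> F X \<otimes> M\<close>, and the cowedge condition on \<open>\<mu>\<close> is
  the naturality of \<open>\<theta>\<close>. So the coend represents \<open>M \<mapsto> Nat(F, F \<otimes> M)\<close>, with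
  \<open>\<delta>\<^sub>F\<close> as universal element; this is (4) and (5). The coalgebra structure is then determined by
  (2): \<open>\<Delta>\<close> and \<open>\<epsilon>\<close> classify the natural transformations \<open>\<a> \<circ> (\<delta> \<otimes> id) \<circ> \<delta>\<close> and
  \<open>\<r>\<^sup>-\<^sup>1\<close>, and each coalgebra axiom holds because both its sides classify the same natural
  transformation.\<close>

section \<open>Calculus of composable arrows\<close>

text \<open>Membership in \<open>hom\<close> is restated through \<open>Arr\<close>, \<open>Dom\<close> and \<open>Cod\<close>, because the
  simplifier can discharge such side conditions without guessing the intermediate objects.\<close>

context category
begin

lemma Ident_arr [simp]:
  assumes "X \<in> Obj C"
  shows "\<i> X \<in> Arr C" "Dom C (\<i> X) = X" "Cod C (\<i> X) = X"
  using Ident_in[OF assms] by (auto simp: hom_def)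

lemma Comp_arr [simp]:
  assumes "f \<in> Arr C" "g \<in> Arr C" "Cod C f = Dom C g"
  shows "g \<cdot> f \<in> Arr C" "Dom C (g \<cdot> f) = Dom C f" "Cod C (g \<cdot> f) = Cod C g"
  using Comp_in[of f "Dom C f" "Dom C g" g "Cod C g"] assms by (auto simp: hom_def)

lemma Comp_Ident_arr [simp]: "\<lbrakk>f \<in> Arr C; Dom C f = X\<rbrakk> \<Longrightarrow> f \<cdot> \<i> X = f"
  using Comp_Ident[of f X "Cod C f"] by (auto simp: hom_def)

lemma Ident_Comp_arr [simp]: "\<lbrakk>f \<in> Arr C; Cod C f = X\<rbrakk> \<Longrightarrow> \<i> X \<cdot> f = f"
  using Ident_Comp[of f "Dom C f" X] by (auto simp: hom_def)

lemma Comp_assoc_arr [simp]: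
  "\<lbrakk>f \<in> Arr C; g \<in> Arr C; k \<in> Arr C; Cod C f = Dom C g; Cod C g = Dom C k\<rbrakk> \<Longrightarrow>
    (k \<cdot> g) \<cdot> f = k \<cdot> g \<cdot> f"
  using Comp_assoc[of f "Dom C f" "Cod C f" g "Cod C g" k "Cod C k"] by (auto simp: hom_def)

text \<open>\<open>simp\<close> nests composites to the right, so an equation for
  \<open>f \<cdot> g\<close> no longer matches once a further arrow is applied first. This is the
  same equation with such a tail \<open>x\<close>.\<close>

lemma Comp_Comp_cong:
  assumes "f \<cdot> g = k" "f \<in> Arr C" "g \<in> Arr C" "x \<in> Arr C" "Cod C x = Dom C g" "Cod C g = Dom C f"
  shows "f \<cdot> g \<cdot> x = k \<cdot> x"
  using assms Comp_assoc_arr[of x g f] by simp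

text \<open>\<open>inverse_arr\<close> is a definite description, so its properties rest on the
  uniqueness of inverses:
  \<open>g' = (g \<cdot> f) \<cdot> g' = g \<cdot> (f \<cdot> g') = g\<close>.\<close>

lemma inverse_arr:
  assumes "is_iso C f"
  shows "inverse_arr C f \<in> hom C (Cod C f) (Dom C f)"
    "inverse_arr C f \<cdot> f = \<i> (Dom C f)" "f \<cdot> inverse_arr C f = \<i> (Cod C f)"
proof -
  obtain g where g: "is_inverse C f g" using assms by (auto simp: is_iso_def)
  have "g' = g" if g': "is_inverse C f g'" for g'
  proof -
    have "g' = (g \<cdot> f) \<cdot> g'"
      using g g' by (simp add: is_inverse_def hom_def del: Comp_assoc_arr)
    also have "\<dots> = g \<cdot> f \<cdot> g'"
      using g g' by (intro Comp_assoc_arr) (simp_all add: is_inverse_def hom_def)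
    also have "\<dots> = g"
      using g g' by (simp add: is_inverse_def hom_def)
    finally show ?thesis .
  qed
  with g have "is_inverse C f (inverse_arr C f)"
    unfolding inverse_arr_def by (rule theI)
  then show "inverse_arr C f \<in> hom C (Cod C f) (Dom C f)"
    "inverse_arr C f \<cdot> f = \<i> (Dom C f)" "f \<cdot> inverse_arr C f = \<i> (Cod C f)"
    by (auto simp: is_inverse_def)
qed

lemma iso_cancel_left:
  assumes "is_iso C k" "k \<cdot> f = k \<cdot> g" "k \<in> Arr C" "f \<in> Arr C" "g \<in> Arr C"
    "Cod C f = Dom C k" "Cod C g = Dom C k"
  shows "f = g"
proof -
  note I = inverse_arr[OF assms(1)]
  have "(inverse_arr C k \<cdot> k) \<cdot> f = (inverse_arr C k \<cdot> k) \<cdot> g"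
    using assms I(1) by (simp add: hom_def)
  then show ?thesis using I(2) assms by simp
qed

lemma iso_cancel_right:
  assumes "is_iso C k" "f \<cdot> k = g \<cdot> k" "k \<in> Arr C" "f \<in> Arr C" "g \<in> Arr C"
    "Dom C f = Cod C k" "Dom C g = Cod C k"
  shows "f = g"
proof -
  note I = inverse_arr[OF assms(1)]
  have "(f \<cdot> k) \<cdot> inverse_arr C k = (g \<cdot> k) \<cdot> inverse_arr C k"
    using assms(2) by simp
  then show ?thesis using I(1,3) assms(3-) by (simp add: hom_def)
qed

end

section \<open>Tensor calculus with explicit associators and unitors\<close>

context monoidal_category
begin

declare tensor_obj_in [simp] unit_in [simp] tensor_Ident [simp]

lemma Dom_Cod_Obj [simp]: "f \<in> Arr C \<Longrightarrow> Dom C f \<in> Obj C" "f \<in> Arr C \<Longrightarrow> Cod C f \<in> Obj C"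
  by (simp_all add: Dom_in Cod_in)

lemma tensor_arr [simp]:
  assumes "f \<in> Arr C" "g \<in> Arr C"
  shows "f \<otimes>\<^sub>m g \<in> Arr C" "Dom C (f \<otimes>\<^sub>m g) = Dom C f \<otimes> Dom C g"
    "Cod C (f \<otimes>\<^sub>m g) = Cod C f \<otimes> Cod C g"
  using tensor_arr_in[of f "Dom C f" "Cod C f" g "Dom C g" "Cod C g"] assms by (auto simp: hom_def)

lemma structure_arr [simp]:
  assumes "X \<in> Obj C"
  shows "\<l> X \<in> Arr C" "Dom C (\<l> X) = \<one> \<otimes> X" "Cod C (\<l> X) = X"
    "\<r> X \<in> Arr C" "Dom C (\<r> X) = X \<otimes> \<one>" "Cod C (\<r> X) = X"
  using lunit_in[OF assms] runit_in[OF assms] by (auto simp: hom_def)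

lemma assoc_arr [simp]:
  assumes "X \<in> Obj C" "Y \<in> Obj C" "Z \<in> Obj C"
  shows "\<a> X Y Z \<in> Arr C" "Dom C (\<a> X Y Z) = (X \<otimes> Y) \<otimes> Z" "Cod C (\<a> X Y Z) = X \<otimes> Y \<otimes> Z"
  using assoc_in[OF assms] by (auto simp: hom_def)

text \<open>The reverse orientation of \<open>tensor_Comp\<close>: consecutive tensor products are
  fused into one. With its tailed form \<open>interchange_Comp\<close> this lets \<open>simp\<close>
  compare composites that differ only by interchange.\<close>

lemma interchange [simp]:
  assumes "f \<in> Arr C" "f' \<in> Arr C" "g \<in> Arr C" "g' \<in> Arr C"
    "Cod C f = Dom C f'" "Cod C g = Dom C g'"
  shows "(f' \<otimes>\<^sub>m g') \<cdot> (f \<otimes>\<^sub>m g) = (f' \<cdot> f) \<otimes>\<^sub>m (g' \<cdot> g)"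
  using tensor_Comp[of f "Dom C f" "Cod C f" f' "Cod C f'" g "Dom C g" "Cod C g" g' "Cod C g'"] assms
  by (simp add: hom_def)

lemma interchange_Comp [simp]:
  assumes "f \<in> Arr C" "f' \<in> Arr C" "g \<in> Arr C" "g' \<in> Arr C" "k \<in> Arr C"
    "Cod C f = Dom C f'" "Cod C g = Dom C g'" "Cod C k = Dom C f \<otimes> Dom C g"
  shows "(f' \<otimes>\<^sub>m g') \<cdot> (f \<otimes>\<^sub>m g) \<cdot> k = ((f' \<cdot> f) \<otimes>\<^sub>m (g' \<cdot> g)) \<cdot> k"
  using Comp_Comp_cong[OF interchange, of f f' g g' k] assms by simp

text \<open>Read from left to right, this moves an associator to the outside of three tensor
  factors. The domains enter as equations, so that they may match up to provable equality
  only.\<close>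

lemma assoc_natural_arr:
  assumes "f \<in> Arr C" "g \<in> Arr C" "k \<in> Arr C"
    "Dom C f = X" "Dom C g = Y" "Dom C k = Z"
  shows "(f \<otimes>\<^sub>m g \<otimes>\<^sub>m k) \<cdot> \<a> X Y Z =
    \<a> (Cod C f) (Cod C g) (Cod C k) \<cdot> ((f \<otimes>\<^sub>m g) \<otimes>\<^sub>m k)"
  using assoc_natural[of f X "Cod C f" g Y "Cod C g" k Z "Cod C k"] assms by (auto simp: hom_def)

lemma assoc_natural_Comp:
  assumes "f \<in> Arr C" "g \<in> Arr C" "k \<in> Arr C" "x \<in> Arr C"
    "Dom C f = X" "Dom C g = Y" "Dom C k = Z" "Cod C x = (X \<otimes> Y) \<otimes> Z"
  shows "(f \<otimes>\<^sub>m g \<otimes>\<^sub>m k) \<cdot> \<a> X Y Z \<cdot> x =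
    \<a> (Cod C f) (Cod C g) (Cod C k) \<cdot> ((f \<otimes>\<^sub>m g) \<otimes>\<^sub>m k) \<cdot> x"
  using Comp_Comp_cong[OF assoc_natural_arr[OF assms(1-3,5-7)], of x] assms by auto

text \<open>Tensoring with \<open>\<one>\<close> is faithful, because \<open>\<r>\<close> is a
  natural isomorphism from it to the identity functor.\<close>

lemma tensor_unit_cancel:
  assumes "f \<otimes>\<^sub>m \<i> \<one> = g \<otimes>\<^sub>m \<i> \<one>" "f \<in> hom C X Y" "g \<in> hom C X Y"
  shows "f = g"
proof (rule iso_cancel_right[OF runit_iso])
  show "X \<in> Obj C" using assms(2) by (auto simp: hom_def)
  show "f \<cdot> \<r> X = g \<cdot> \<r> X"
    using runit_natural[OF assms(2)] runit_natural[OF assms(3)] assms(1) by simp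
qed (use assms in \<open>auto simp: hom_def\<close>)

text \<open>Kelly's argument: after tensoring with \<open>\<one>\<close> on the right, the identity is a combination of
  the pentagon with two instances of the triangle.\<close>

lemma runit_tensor:
  assumes "X \<in> Obj C" "Y \<in> Obj C"
  shows "(\<i> X \<otimes>\<^sub>m \<r> Y) \<cdot> \<a> X Y \<one> = \<r> (X \<otimes> Y)"
proof (rule tensor_unit_cancel)
  let ?I = "\<one>"
  show "((\<i> X \<otimes>\<^sub>m \<r> Y) \<cdot> \<a> X Y ?I) \<otimes>\<^sub>m \<i> ?I = \<r> (X \<otimes> Y) \<otimes>\<^sub>m \<i> ?I"
  \<comment> \<open>Composing with an invertible associator brings the left side into a form that
    contains one side of the pentagon.\<close>
  proof (rule iso_cancel_left[OF assoc_iso[of X Y ?I]])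
    have "\<a> X Y ?I \<cdot> (((\<i> X \<otimes>\<^sub>m \<r> Y) \<cdot> \<a> X Y ?I) \<otimes>\<^sub>m \<i> ?I) =
        \<a> X Y ?I \<cdot> ((\<i> X \<otimes>\<^sub>m \<r> Y) \<otimes>\<^sub>m \<i> ?I) \<cdot> (\<a> X Y ?I \<otimes>\<^sub>m \<i> ?I)"
      using assms by simp
    also have "\<dots> = (\<i> X \<otimes>\<^sub>m (\<r> Y \<otimes>\<^sub>m \<i> ?I)) \<cdot> \<a> X (Y \<otimes> ?I) ?I \<cdot> (\<a> X Y ?I \<otimes>\<^sub>m \<i> ?I)"
      using assms assoc_natural_Comp[of "\<i> X" "\<r> Y" "\<i> ?I" "\<a> X Y ?I \<otimes>\<^sub>m \<i> ?I" X "Y \<otimes> ?I" ?I] by simp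
    \<comment> \<open>The first triangle, at \<open>Y\<close> and \<open>\<one>\<close>, expands
      \<open>\<r> Y\<close>; the second, at \<open>X \<otimes> Y\<close> and \<open>\<one>\<close>,
      closes the chain after the pentagon.\<close>
    also have "\<dots> = (\<i> X \<otimes>\<^sub>m (\<i> Y \<otimes>\<^sub>m \<l> ?I)) \<cdot>
        (\<i> X \<otimes>\<^sub>m \<a> Y ?I ?I) \<cdot> \<a> X (Y \<otimes> ?I) ?I \<cdot> (\<a> X Y ?I \<otimes>\<^sub>m \<i> ?I)"
      using assms by (simp add: triangle)
    also have "\<dots> = (\<i> X \<otimes>\<^sub>m (\<i> Y \<otimes>\<^sub>m \<l> ?I)) \<cdot> \<a> X Y (?I \<otimes> ?I) \<cdot> \<a> (X \<otimes> Y) ?I ?I"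
      using assms by (simp only: pentagon unit_in)
    also have "\<dots> = \<a> X Y ?I \<cdot> ((\<i> X \<otimes>\<^sub>m \<i> Y) \<otimes>\<^sub>m \<l> ?I) \<cdot> \<a> (X \<otimes> Y) ?I ?I"
      using assms assoc_natural_Comp[of "\<i> X" "\<i> Y" "\<l> ?I" "\<a> (X \<otimes> Y) ?I ?I" X Y "?I \<otimes> ?I"] by simp
    also have "\<dots> = \<a> X Y ?I \<cdot> (\<r> (X \<otimes> Y) \<otimes>\<^sub>m \<i> ?I)"
      using assms by (simp add: triangle)
    finally show "\<a> X Y ?I \<cdot> (((\<i> X \<otimes>\<^sub>m \<r> Y) \<cdot> \<a> X Y ?I) \<otimes>\<^sub>m \<i> ?I) =
      \<a> X Y ?I \<cdot> (\<r> (X \<otimes> Y) \<otimes>\<^sub>m \<i> ?I)" .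
  qed (use assms in auto)
qed (use assms in \<open>auto simp: hom_def\<close>)

lemma inverse_runit:
  assumes "X \<in> Obj C"
  shows "inverse_arr C (\<r> X) \<in> hom C X (X \<otimes> \<one>)"
    "inverse_arr C (\<r> X) \<cdot> \<r> X = \<i> (X \<otimes> \<one>)" "\<r> X \<cdot> inverse_arr C (\<r> X) = \<i> X"
  using inverse_arr[OF runit_iso[OF assms]] assms by simp_all

lemma inverse_runit_natural:
  assumes "f \<in> hom C X Y"
  shows "(f \<otimes>\<^sub>m \<i> \<one>) \<cdot> inverse_arr C (\<r> X) = inverse_arr C (\<r> Y) \<cdot> f"
proof (rule iso_cancel_left[OF runit_iso[of Y]])
  have o: "X \<in> Obj C" "Y \<in> Obj C" "f \<in> Arr C" "Dom C f = X" "Cod C f = Y"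
    using assms by (auto simp: hom_def)
  note I = inverse_runit[OF o(1)] inverse_runit[OF o(2)]
  note Ia = I(1,4)[unfolded hom_def, simplified]
  have "\<r> Y \<cdot> (f \<otimes>\<^sub>m \<i> \<one>) \<cdot> inverse_arr C (\<r> X) = (f \<cdot> \<r> X) \<cdot> inverse_arr C (\<r> X)"
    using Comp_Comp_cong[OF runit_natural[OF assms], of "inverse_arr C (\<r> X)"] o Ia by simp
  also have "\<dots> = f" using o Ia I(3) by simp
  also have "\<dots> = \<r> Y \<cdot> inverse_arr C (\<r> Y) \<cdot> f"
    using Comp_Comp_cong[OF I(6), of f] o Ia by simp
  finally show "\<r> Y \<cdot> (f \<otimes>\<^sub>m \<i> \<one>) \<cdot> inverse_arr C (\<r> X) = \<r> Y \<cdot> inverse_arr C (\<r> Y) \<cdot> f" .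
  show "Y \<in> Obj C" "\<r> Y \<in> Arr C" "(f \<otimes>\<^sub>m \<i> \<one>) \<cdot> inverse_arr C (\<r> X) \<in> Arr C"
    "inverse_arr C (\<r> Y) \<cdot> f \<in> Arr C" "Cod C ((f \<otimes>\<^sub>m \<i> \<one>) \<cdot> inverse_arr C (\<r> X)) = Dom C (\<r> Y)"
    "Cod C (inverse_arr C (\<r> Y) \<cdot> f) = Dom C (\<r> Y)"
    using o Ia by simp_all
qed

end

section \<open>Coalgebra structure from a universal coaction\<close>

text \<open>\<open>nat_trans\<close> includes functoriality of both sides. Functoriality of
  \<open>F \<otimes> M\<close> is settled here once, which leaves only the conditions on
  components.\<close>

lemma nat_trans_tensor_iff:
  assumes "monoidal_category C" "cat_functor D C F" "M \<in> Obj C"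
  shows "nat_trans D C F (func_tensor C F M) \<theta> \<longleftrightarrow>
    (\<forall>X \<in> Obj D. \<theta> X \<in> hom C (omap F X) (omap F X \<otimes>\<^bsub>C\<^esub> M)) \<and>
    (\<forall>X Y. \<forall>f \<in> hom D X Y.
      (amap F f \<otimes>\<^sub>m\<^bsub>C\<^esub> \<i>\<^bsub>C\<^esub> M) \<cdot>\<^bsub>C\<^esub> \<theta> X = \<theta> Y \<cdot>\<^bsub>C\<^esub> amap F f)"
proof -
  interpret monoidal_category C by fact
  interpret F: cat_functor D C F by fact
  have "cat_functor D C (func_tensor C F M)"
  proof (unfold_locales, goal_cases)
    case (1 X)
    then show ?case using F.omap_in assms(3) by (simp add: func_tensor_def)
  next
    case (2 f X Y)
    then show ?case using F.amap_in assms(3) by (simp add: func_tensor_def tensor_arr_in Ident_in)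
  next
    case (3 X)
    then show ?case using F.omap_in assms(3) by (simp add: func_tensor_def F.amap_Ident)
  next
    case (4 f X Y g Z)
    then show ?case using F.amap_in[OF 4(1)] F.amap_in[OF 4(2)] assms(3)
      by (simp add: func_tensor_def F.amap_Comp hom_def)
  qed
  with assms(2) show ?thesis
    by (auto simp: nat_trans_def nat_trans_axioms_def func_tensor_def)
qed

text \<open>Abstracts from cohomomorphism objects. \<open>coaction_ext\<close> is the uniqueness
  half of representability: arrows out of \<open>E\<close> are detected by the coactions. The
  existence half enters below through given \<open>\<Delta>\<close> and \<open>\<epsilon>\<close>
  with their defining equations.\<close>

locale universal_coaction = monoidal_category C + F: cat_functor D C F
  for C :: "('o, 'm, 'z) moncat_scheme" (structure) and D :: "('d, 'e, 'y) cat_scheme"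
    and F :: "('d, 'e, 'o, 'm) func" +
  fixes E :: 'o and \<delta> :: "'d \<Rightarrow> 'm"
  assumes E_in [simp]: "E \<in> Obj C"
    and coaction_natural: "nat_trans D C F (func_tensor C F E) \<delta>"
    and coaction_ext: "\<lbrakk>u \<in> hom C E M; v \<in> hom C E M;
      \<And>X. X \<in> Obj D \<Longrightarrow> (\<i> (omap F X) \<otimes>\<^sub>m u) \<cdot> \<delta> X = (\<i> (omap F X) \<otimes>\<^sub>m v) \<cdot> \<delta> X\<rbrakk> \<Longrightarrow> u = v"
begin

lemma F_arr [simp]:
  assumes "f \<in> hom D X Y"
  shows "amap F f \<in> Arr C" "Dom C (amap F f) = omap F X" "Cod C (amap F f) = omap F Y"
  using F.amap_in[OF assms] by (auto simp: hom_def)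

lemma F_obj [simp]: "X \<in> Obj D \<Longrightarrow> omap F X \<in> Obj C"
  by (rule F.omap_in)

lemma coaction_arr [simp]:
  assumes "X \<in> Obj D"
  shows "\<delta> X \<in> Arr C" "Dom C (\<delta> X) = omap F X" "Cod C (\<delta> X) = omap F X \<otimes> E"
  using nat_trans.component_in[OF coaction_natural assms] by (auto simp: hom_def func_tensor_def)

lemma coaction_naturality:
  "f \<in> hom D X Y \<Longrightarrow> (amap F f \<otimes>\<^sub>m \<i> E) \<cdot> \<delta> X = \<delta> Y \<cdot> amap F f"
  using nat_trans.naturality[OF coaction_natural] by (simp add: func_tensor_def)

text \<open>The transformation that \<open>\<Delta>\<close> is to classify. Naturality of
  \<open>\<delta>\<close> is used twice, first inside the tensor product with \<open>E\<close> and
  then outside it.\<close>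

lemma double_coaction_natural:
  "nat_trans D C F (func_tensor C F (E \<otimes> E))
    (\<lambda>X. \<a> (omap F X) E E \<cdot> (\<delta> X \<otimes>\<^sub>m \<i> E) \<cdot> \<delta> X)"
proof (unfold nat_trans_tensor_iff[OF monoidal_category_axioms F.cat_functor_axioms tensor_obj_in[OF E_in E_in]],
    intro conjI allI ballI)
  fix X assume "X \<in> Obj D"
  then show "\<a> (omap F X) E E \<cdot> (\<delta> X \<otimes>\<^sub>m \<i> E) \<cdot> \<delta> X \<in> hom C (omap F X) (omap F X \<otimes> E \<otimes> E)"
    by (simp add: hom_def)
next
  fix X Y f assume f: "f \<in> hom D X Y"
  then have o [simp]: "X \<in> Obj D" "Y \<in> Obj D" by (auto simp: hom_def F.A.Dom_in F.A.Cod_in)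
  let ?F = "omap F" and ?f = "amap F f"
  note [simp] = F_arr[OF f]
  have "(?f \<otimes>\<^sub>m \<i> (E \<otimes> E)) \<cdot> \<a> (?F X) E E \<cdot> (\<delta> X \<otimes>\<^sub>m \<i> E) \<cdot> \<delta> X =
      \<a> (?F Y) E E \<cdot> (((?f \<otimes>\<^sub>m \<i> E) \<cdot> \<delta> X) \<otimes>\<^sub>m \<i> E) \<cdot> \<delta> X"
    using assoc_natural_Comp[of ?f "\<i> E" "\<i> E" "(\<delta> X \<otimes>\<^sub>m \<i> E) \<cdot> \<delta> X" "?F X" E E] by simp
  also have "\<dots> = \<a> (?F Y) E E \<cdot> ((\<delta> Y \<cdot> ?f) \<otimes>\<^sub>m \<i> E) \<cdot> \<delta> X"
    by (simp only: coaction_naturality[OF f])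
  also have "\<dots> = \<a> (?F Y) E E \<cdot> (\<delta> Y \<otimes>\<^sub>m \<i> E) \<cdot> (?f \<otimes>\<^sub>m \<i> E) \<cdot> \<delta> X"
    by simp
  also have "\<dots> = (\<a> (?F Y) E E \<cdot> (\<delta> Y \<otimes>\<^sub>m \<i> E) \<cdot> \<delta> Y) \<cdot> ?f"
    by (simp only: coaction_naturality[OF f]) simp
  finally show "(?f \<otimes>\<^sub>m \<i> (E \<otimes> E)) \<cdot> \<a> (?F X) E E \<cdot> (\<delta> X \<otimes>\<^sub>m \<i> E) \<cdot> \<delta> X =
    (\<a> (?F Y) E E \<cdot> (\<delta> Y \<otimes>\<^sub>m \<i> E) \<cdot> \<delta> Y) \<cdot> ?f" .
qed

lemma inverse_runit_nat_trans:
  "nat_trans D C F (func_tensor C F \<one>) (\<lambda>X. inverse_arr C (\<r> (omap F X)))"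
  unfolding nat_trans_tensor_iff[OF monoidal_category_axioms F.cat_functor_axioms unit_in]
  by (auto intro: inverse_runit inverse_runit_natural F.amap_in)

text \<open>\<open>comult\<close> and \<open>counit\<close> are the comodule axioms read as
  descriptions of \<open>\<Delta>\<close> and \<open>\<epsilon>\<close>. By
  \<open>coaction_ext\<close> each coalgebra axiom may be tested on the coactions, where these
  equations replace \<open>\<Delta>\<close> and \<open>\<epsilon>\<close> by iterated coactions and
  \<open>\<r>\<close> inverse.\<close>

lemma coalgebra_of_universal:
  assumes \<Delta>: "\<Delta> \<in> hom C E (E \<otimes> E)"
    and \<epsilon>: "\<epsilon> \<in> hom C E \<one>"
    and comult: "\<And>X. X \<in> Obj D \<Longrightarrow>
      (\<i> (omap F X) \<otimes>\<^sub>m \<Delta>) \<cdot> \<delta> X = \<a> (omap F X) E E \<cdot> (\<delta> X \<otimes>\<^sub>m \<i> E) \<cdot> \<delta> X"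
    and counit: "\<And>X. X \<in> Obj D \<Longrightarrow>
      (\<i> (omap F X) \<otimes>\<^sub>m \<epsilon>) \<cdot> \<delta> X = inverse_arr C (\<r> (omap F X))"
  shows "coalgebra C E \<Delta> \<epsilon>"
proof -
  have [simp]: "\<Delta> \<in> Arr C" "Dom C \<Delta> = E" "Cod C \<Delta> = E \<otimes> E"
    "\<epsilon> \<in> Arr C" "Dom C \<epsilon> = E" "Cod C \<epsilon> = \<one>"
    using \<Delta> \<epsilon> by (auto simp: hom_def)
  let ?F = "omap F"
  \<comment> \<open>Used for all three axioms: a \<open>\<Delta>\<close> that is applied first is
    traded for the double coaction.\<close>
  have Delta_Comp: "(\<i> (?F X) \<otimes>\<^sub>m (u \<cdot> \<Delta>)) \<cdot> \<delta> X =
      (\<i> (?F X) \<otimes>\<^sub>m u) \<cdot> \<a> (?F X) E E \<cdot> (\<delta> X \<otimes>\<^sub>m \<i> E) \<cdot> \<delta> X"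
    if "X \<in> Obj D" "u \<in> Arr C" "Dom C u = E \<otimes> E" for u X
  proof -
    have "(\<i> (?F X) \<otimes>\<^sub>m (u \<cdot> \<Delta>)) \<cdot> \<delta> X = (\<i> (?F X) \<otimes>\<^sub>m u) \<cdot> (\<i> (?F X) \<otimes>\<^sub>m \<Delta>) \<cdot> \<delta> X"
      using that by simp
    then show ?thesis using that by (simp only: comult)
  qed
  have coassoc: "\<a> E E E \<cdot> (\<Delta> \<otimes>\<^sub>m \<i> E) \<cdot> \<Delta> = (\<i> E \<otimes>\<^sub>m \<Delta>) \<cdot> \<Delta>"
  proof (rule coaction_ext)
    fix X assume X [simp]: "X \<in> Obj D"
    let ?\<delta>\<delta> = "(\<delta> X \<otimes>\<^sub>m \<i> E) \<cdot> \<delta> X" and ?\<delta>3 = "((\<delta> X \<otimes>\<^sub>m \<i> E) \<otimes>\<^sub>m \<i> E) \<cdot> (\<delta> X \<otimes>\<^sub>m \<i> E) \<cdot> \<delta> X"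
    \<comment> \<open>Rebracketed to the shape \<open>u \<cdot> \<Delta>\<close> that
      \<open>Delta_Comp\<close> expects; the counit laws start in the same way.\<close>
    have "(\<i> (?F X) \<otimes>\<^sub>m (\<a> E E E \<cdot> (\<Delta> \<otimes>\<^sub>m \<i> E) \<cdot> \<Delta>)) \<cdot> \<delta> X =
        (\<i> (?F X) \<otimes>\<^sub>m ((\<a> E E E \<cdot> (\<Delta> \<otimes>\<^sub>m \<i> E)) \<cdot> \<Delta>)) \<cdot> \<delta> X"
      by simp
    also have "\<dots> = (\<i> (?F X) \<otimes>\<^sub>m \<a> E E E) \<cdot> (\<i> (?F X) \<otimes>\<^sub>m \<Delta> \<otimes>\<^sub>m \<i> E) \<cdot> \<a> (?F X) E E \<cdot> ?\<delta>\<delta>"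
      by (subst Delta_Comp) simp_all
    also have "(\<i> (?F X) \<otimes>\<^sub>m \<Delta> \<otimes>\<^sub>m \<i> E) \<cdot> \<a> (?F X) E E \<cdot> ?\<delta>\<delta> =
        \<a> (?F X) (E \<otimes> E) E \<cdot> (((\<i> (?F X) \<otimes>\<^sub>m \<Delta>) \<cdot> \<delta> X) \<otimes>\<^sub>m \<i> E) \<cdot> \<delta> X"
      by (subst assoc_natural_Comp) simp_all
    also have "\<dots> = \<a> (?F X) (E \<otimes> E) E \<cdot> (\<a> (?F X) E E \<otimes>\<^sub>m \<i> E) \<cdot> ?\<delta>3"
      by (simp add: comult)
    also have "(\<i> (?F X) \<otimes>\<^sub>m \<a> E E E) \<cdot> \<dots> =
        ((\<i> (?F X) \<otimes>\<^sub>m \<a> E E E) \<cdot> \<a> (?F X) (E \<otimes> E) E \<cdot> (\<a> (?F X) E E \<otimes>\<^sub>m \<i> E)) \<cdot> ?\<delta>3"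
      by simp
    \<comment> \<open>The pentagon at \<open>F X, E, E, E\<close> rebrackets the threefold coaction
      \<open>?\<delta>3\<close>, through which the two sides are compared.\<close>
    also have "\<dots> = (\<a> (?F X) E (E \<otimes> E) \<cdot> \<a> (?F X \<otimes> E) E E) \<cdot> ?\<delta>3"
      by (simp only: pentagon E_in F_obj X)
    also have "\<dots> = \<a> (?F X) E (E \<otimes> E) \<cdot> \<a> (?F X \<otimes> E) E E \<cdot> ?\<delta>3"
      by simp
    \<comment> \<open>From here coactions are folded back: the inner double coaction becomes
      \<open>\<Delta>\<close>, which slides past \<open>\<delta> X\<close> by interchange, and the
      remaining double coaction becomes the second \<open>\<Delta>\<close>.\<close>
    also have "\<a> (?F X \<otimes> E) E E \<cdot> ?\<delta>3 = (\<delta> X \<otimes>\<^sub>m \<i> (E \<otimes> E)) \<cdot> \<a> (?F X) E E \<cdot> ?\<delta>\<delta>"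
      using assoc_natural_Comp[of "\<delta> X" "\<i> E" "\<i> E" ?\<delta>\<delta> "?F X" E E] by simp
    also have "\<a> (?F X) E E \<cdot> ?\<delta>\<delta> = (\<i> (?F X) \<otimes>\<^sub>m \<Delta>) \<cdot> \<delta> X"
      by (simp add: comult)
    also have "\<a> (?F X) E (E \<otimes> E) \<cdot> (\<delta> X \<otimes>\<^sub>m \<i> (E \<otimes> E)) \<cdot> (\<i> (?F X) \<otimes>\<^sub>m \<Delta>) \<cdot> \<delta> X =
        \<a> (?F X) E (E \<otimes> E) \<cdot> ((\<i> (?F X) \<otimes>\<^sub>m \<i> E) \<otimes>\<^sub>m \<Delta>) \<cdot> ?\<delta>\<delta>"
      by simp
    also have "\<dots> = (\<i> (?F X) \<otimes>\<^sub>m \<i> E \<otimes>\<^sub>m \<Delta>) \<cdot> \<a> (?F X) E E \<cdot> ?\<delta>\<delta>"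
      by (subst assoc_natural_Comp) simp_all
    also have "\<dots> = (\<i> (?F X) \<otimes>\<^sub>m ((\<i> E \<otimes>\<^sub>m \<Delta>) \<cdot> \<Delta>)) \<cdot> \<delta> X"
      by (subst Delta_Comp) simp_all
    finally show "(\<i> (?F X) \<otimes>\<^sub>m (\<a> E E E \<cdot> (\<Delta> \<otimes>\<^sub>m \<i> E) \<cdot> \<Delta>)) \<cdot> \<delta> X =
      (\<i> (?F X) \<otimes>\<^sub>m ((\<i> E \<otimes>\<^sub>m \<Delta>) \<cdot> \<Delta>)) \<cdot> \<delta> X" .
  qed (simp_all add: hom_def)
  have left: "\<l> E \<cdot> (\<epsilon> \<otimes>\<^sub>m \<i> E) \<cdot> \<Delta> = \<i> E"
  proof (rule coaction_ext)
    fix X assume X [simp]: "X \<in> Obj D"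
    note I = inverse_runit[OF F_obj[OF X]]
    have Ia: "inverse_arr C (\<r> (?F X)) \<in> Arr C" "Dom C (inverse_arr C (\<r> (?F X))) = ?F X"
      "Cod C (inverse_arr C (\<r> (?F X))) = ?F X \<otimes> \<one>"
      using I(1) by (auto simp: hom_def)
    have "(\<i> (?F X) \<otimes>\<^sub>m (\<l> E \<cdot> (\<epsilon> \<otimes>\<^sub>m \<i> E) \<cdot> \<Delta>)) \<cdot> \<delta> X =
        (\<i> (?F X) \<otimes>\<^sub>m ((\<l> E \<cdot> (\<epsilon> \<otimes>\<^sub>m \<i> E)) \<cdot> \<Delta>)) \<cdot> \<delta> X"
      by simp
    also have "\<dots> = (\<i> (?F X) \<otimes>\<^sub>m \<l> E) \<cdot> (\<i> (?F X) \<otimes>\<^sub>m \<epsilon> \<otimes>\<^sub>m \<i> E) \<cdot>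
        \<a> (?F X) E E \<cdot> (\<delta> X \<otimes>\<^sub>m \<i> E) \<cdot> \<delta> X"
      by (subst Delta_Comp) simp_all
    also have "\<dots> = (\<i> (?F X) \<otimes>\<^sub>m \<l> E) \<cdot> \<a> (?F X) \<one> E \<cdot> (((\<i> (?F X) \<otimes>\<^sub>m \<epsilon>) \<cdot> \<delta> X) \<otimes>\<^sub>m \<i> E) \<cdot> \<delta> X"
      by (subst assoc_natural_Comp) simp_all
    \<comment> \<open>The triangle turns \<open>\<l> E\<close> into \<open>\<r> (?F X)\<close>,
      which then cancels against the inverse supplied by \<open>counit\<close>.\<close>
    also have "\<dots> = (\<r> (?F X) \<otimes>\<^sub>m \<i> E) \<cdot> (inverse_arr C (\<r> (?F X)) \<otimes>\<^sub>m \<i> E) \<cdot> \<delta> X"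
      using Ia by (subst Comp_Comp_cong[OF triangle]) (simp_all add: counit)
    also have "\<dots> = (\<i> (?F X) \<otimes>\<^sub>m \<i> E) \<cdot> \<delta> X"
      using Ia I(3) by simp
    finally show "(\<i> (?F X) \<otimes>\<^sub>m (\<l> E \<cdot> (\<epsilon> \<otimes>\<^sub>m \<i> E) \<cdot> \<Delta>)) \<cdot> \<delta> X = (\<i> (?F X) \<otimes>\<^sub>m \<i> E) \<cdot> \<delta> X" .
  qed (simp_all add: hom_def)
  have right: "\<r> E \<cdot> (\<i> E \<otimes>\<^sub>m \<epsilon>) \<cdot> \<Delta> = \<i> E"
  proof (rule coaction_ext)
    fix X assume X [simp]: "X \<in> Obj D"
    note I = inverse_runit[OF F_obj[OF X]]
    have Ia: "inverse_arr C (\<r> (?F X)) \<in> Arr C" "Dom C (inverse_arr C (\<r> (?F X))) = ?F X"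
      "Cod C (inverse_arr C (\<r> (?F X))) = ?F X \<otimes> \<one>"
      using I(1) by (auto simp: hom_def)
    have "(\<i> (?F X) \<otimes>\<^sub>m (\<r> E \<cdot> (\<i> E \<otimes>\<^sub>m \<epsilon>) \<cdot> \<Delta>)) \<cdot> \<delta> X =
        (\<i> (?F X) \<otimes>\<^sub>m ((\<r> E \<cdot> (\<i> E \<otimes>\<^sub>m \<epsilon>)) \<cdot> \<Delta>)) \<cdot> \<delta> X"
      by simp
    also have "\<dots> = (\<i> (?F X) \<otimes>\<^sub>m \<r> E) \<cdot> (\<i> (?F X) \<otimes>\<^sub>m \<i> E \<otimes>\<^sub>m \<epsilon>) \<cdot>
        \<a> (?F X) E E \<cdot> (\<delta> X \<otimes>\<^sub>m \<i> E) \<cdot> \<delta> X"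
      by (subst Delta_Comp) simp_all
    also have "\<dots> = (\<i> (?F X) \<otimes>\<^sub>m \<r> E) \<cdot> \<a> (?F X) E \<one> \<cdot>
        (\<delta> X \<otimes>\<^sub>m \<i> \<one>) \<cdot> (\<i> (?F X) \<otimes>\<^sub>m \<epsilon>) \<cdot> \<delta> X"
      by (subst assoc_natural_Comp) simp_all
    \<comment> \<open>\<open>runit_tensor\<close> absorbs the associator; naturality of
      \<open>\<r>\<close> then moves \<open>\<delta> X\<close> out, so that \<open>\<r>\<close>
      meets its inverse.\<close>
    also have "\<dots> = (\<r> (?F X \<otimes> E) \<cdot> (\<delta> X \<otimes>\<^sub>m \<i> \<one>)) \<cdot> inverse_arr C (\<r> (?F X))"
      using Ia by (subst Comp_Comp_cong[OF runit_tensor]) (simp_all add: counit)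
    also have "\<r> (?F X \<otimes> E) \<cdot> (\<delta> X \<otimes>\<^sub>m \<i> \<one>) = \<delta> X \<cdot> \<r> (?F X)"
      by (rule runit_natural) (simp add: hom_def)
    also have "(\<delta> X \<cdot> \<r> (?F X)) \<cdot> inverse_arr C (\<r> (?F X)) = (\<i> (?F X) \<otimes>\<^sub>m \<i> E) \<cdot> \<delta> X"
      using Ia I(3) by simp
    finally show "(\<i> (?F X) \<otimes>\<^sub>m (\<r> E \<cdot> (\<i> E \<otimes>\<^sub>m \<epsilon>) \<cdot> \<Delta>)) \<cdot> \<delta> X = (\<i> (?F X) \<otimes>\<^sub>m \<i> E) \<cdot> \<delta> X" .
  qed (simp_all add: hom_def)
  show ?thesis
    by unfold_locales (use \<Delta> \<epsilon> coassoc left right in auto)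
qed

text \<open>Coassociativity is \<open>comult\<close> read backwards; the counit law is
  \<open>\<r>\<close> composed with its inverse.\<close>

lemma comodule_of_universal:
  assumes "\<Delta> \<in> hom C E (E \<otimes> E)" "\<epsilon> \<in> hom C E \<one>"
    and comult: "\<And>X. X \<in> Obj D \<Longrightarrow>
      (\<i> (omap F X) \<otimes>\<^sub>m \<Delta>) \<cdot> \<delta> X = \<a> (omap F X) E E \<cdot> (\<delta> X \<otimes>\<^sub>m \<i> E) \<cdot> \<delta> X"
    and counit: "\<And>X. X \<in> Obj D \<Longrightarrow>
      (\<i> (omap F X) \<otimes>\<^sub>m \<epsilon>) \<cdot> \<delta> X = inverse_arr C (\<r> (omap F X))"
    and X: "X \<in> Obj D"
  shows "right_comodule C E \<Delta> \<epsilon> (omap F X) (\<delta> X)"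
  unfolding right_comodule_def right_comodule_axioms_def
  using coalgebra_of_universal[OF assms(1,2) comult counit] X
    inverse_runit(3)[OF F_obj[OF X]]
  by (simp add: comult counit hom_def)

end

section \<open>Cowedges as natural transformations\<close>

text \<open>\<open>F\<close> lands in the subcategory, but \<open>M\<close> and the coend need not
  lie there, so \<open>F \<otimes> M\<close> and its natural transformations are formed in
  \<open>C\<close>.\<close>

lemma (in subcategory) functor_into_supercategory:
  assumes "cat_functor D S F"
  shows "cat_functor D C F"
proof -
  interpret F: cat_functor D S F by fact
  have hom_SC: "f \<in> hom C X Y" if "f \<in> hom S X Y" for f X Y
    using that Arr_subset Dom_eq Cod_eq by (auto simp: hom_def)
  show ?thesis
    by unfold_locales
      (use F.omap_in Obj_subset F.amap_in hom_SC Comp_eq[OF F.amap_in F.amap_in]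
        in \<open>auto simp: F.amap_Ident Ident_eq F.amap_Comp\<close>)
qed

context right_coclosed_subcategory
begin

text \<open>\<open>coend_coaction\<close> is applied to arbitrary families \<open>\<mu>\<close>, not
  only to the universal cowedge: it is the passage from \<open>\<mu>\<close> to
  \<open>\<theta>\<close>.\<close>

lemma coend_coaction_in:
  assumes "omap F X \<in> Obj S" "\<mu> X \<in> hom C (h (omap F X) (omap F X)) M"
  shows "coend_coaction C ev F \<mu> X \<in> hom C (omap F X) (omap F X \<otimes> M)"
  unfolding coend_coaction_def
  using cohomD(2)[OF assms(1,1)] assms Obj_subset by (auto simp: hom_def)

lemma coend_coaction_Comp:
  assumes "omap F X \<in> Obj S" "\<mu> X \<in> hom C (h (omap F X) (omap F X)) M" "u \<in> hom C M N"
  shows "(\<i> (omap F X) \<otimes>\<^sub>m (u \<cdot> \<mu> X)) \<cdot> ev (omap F X) (omap F X) =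
    (\<i> (omap F X) \<otimes>\<^sub>m u) \<cdot> coend_coaction C ev F \<mu> X"
  unfolding coend_coaction_def
  using cohomD(2)[OF assms(1,1)] assms Obj_subset by (auto simp: hom_def)

text \<open>Both sides of the cowedge condition at \<open>f\<close> are arrows out of
  \<open>cohom(F X, F Y)\<close>, hence equal exactly if they agree after coevaluation. By
  \<open>Cohom_arr\<close> these composites are the two sides of the naturality square of
  \<open>\<theta>\<close> at \<open>f\<close>.\<close>

lemma cowedge_iff_nat_trans:
  assumes F: "cat_functor D S F" and M: "M \<in> Obj C"
  shows "cowedge D C (Cohom_func C h ev F) M \<mu> \<longleftrightarrow>
    (\<forall>X \<in> Obj D. \<mu> X \<in> hom C (h (omap F X) (omap F X)) M) \<and>
    nat_trans D C F (func_tensor C F M) (coend_coaction C ev F \<mu>)"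
proof (cases "\<forall>X \<in> Obj D. \<mu> X \<in> hom C (h (omap F X) (omap F X)) M")
  case False
  then show ?thesis by (auto simp: cowedge_def Cohom_func_def func_comp_def func_prod_def Cohom_def)
next
  case True
  interpret F: cat_functor D S F by fact
  let ?F = "omap F" and ?G = "Cohom_func C h ev F" and ?\<theta> = "coend_coaction C ev F \<mu>"
  have condition: "\<mu> X \<cdot> amap ?G (\<i>\<^bsub>D\<^esub> X, f) = \<mu> Y \<cdot> amap ?G (f, \<i>\<^bsub>D\<^esub> Y) \<longleftrightarrow>
      (amap F f \<otimes>\<^sub>m \<i> M) \<cdot> ?\<theta> X = ?\<theta> Y \<cdot> amap F f"
    if f: "f \<in> hom D X Y" for X Y f
  proof -
    have XY: "X \<in> Obj D" "Y \<in> Obj D" using f by (auto simp: hom_def F.A.Dom_in F.A.Cod_in)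
    then have oS: "?F X \<in> Obj S" "?F Y \<in> Obj S" using F.omap_in by auto
    then have oC [simp]: "?F X \<in> Obj C" "?F Y \<in> Obj C" using Obj_subset by auto
    note Ff = F.amap_in[OF f]
    have fC [simp]: "amap F f \<in> Arr C" "Dom C (amap F f) = ?F X" "Cod C (amap F f) = ?F Y"
      using hom_SC[OF Ff] by (auto simp: hom_def)
    note H [simp] = cohomD(1)[OF oS(1,1)] cohomD(1)[OF oS(1,2)] cohomD(1)[OF oS(2,2)]
    have evs [simp]: "ev (?F Z) (?F W) \<in> Arr C" "Dom C (ev (?F Z) (?F W)) = ?F Z"
      "Cod C (ev (?F Z) (?F W)) = ?F W \<otimes> h (?F Z) (?F W)"
      if "Z \<in> {X, Y}" "W \<in> {X, Y}" for Z W
      using cohomD(2)[of "?F Z" "?F W"] that oS by (auto simp: hom_def)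
    have \<mu> [simp]: "\<mu> Z \<in> Arr C" "Dom C (\<mu> Z) = h (?F Z) (?F Z)" "Cod C (\<mu> Z) = M"
      if "Z \<in> {X, Y}" for Z
      using True XY that by (auto simp: hom_def)
    \<comment> \<open>The two arrows out of the mixed object \<open>cohom(F X, F Y)\<close>:
      \<open>?L\<close> leads to \<open>cohom(F X, F X)\<close> and \<open>?R\<close> to
      \<open>cohom(F Y, F Y)\<close>.\<close>
    let ?L = "amap (Cohom C h ev) (\<i>\<^bsub>S\<^esub> (?F X), amap F f)"
      and ?R = "amap (Cohom C h ev) (amap F f, \<i>\<^bsub>S\<^esub> (?F Y))"
    note L = Cohom_arr[OF S.Ident_in[OF oS(1)] Ff] and R = Cohom_arr[OF Ff S.Ident_in[OF oS(2)]]
    have La [simp]: "?L \<in> Arr C" "Dom C ?L = h (?F X) (?F Y)" "Cod C ?L = h (?F X) (?F X)"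
      and Ra [simp]: "?R \<in> Arr C" "Dom C ?R = h (?F X) (?F Y)" "Cod C ?R = h (?F Y) (?F Y)"
      using L(1) R(1) by (auto simp: hom_def)
    have "(\<i> (?F Y) \<otimes>\<^sub>m (\<mu> X \<cdot> ?L)) \<cdot> ev (?F X) (?F Y) =
        (\<i> (?F Y) \<otimes>\<^sub>m \<mu> X) \<cdot> (\<i> (?F Y) \<otimes>\<^sub>m ?L) \<cdot> ev (?F X) (?F Y)"
      by simp
    also have "\<dots> = (amap F f \<otimes>\<^sub>m \<i> M) \<cdot> ?\<theta> X"
      unfolding L(2) coend_coaction_def using M oS by (simp add: Ident_eq)
    finally have l: "(\<i> (?F Y) \<otimes>\<^sub>m (\<mu> X \<cdot> ?L)) \<cdot> ev (?F X) (?F Y) = (amap F f \<otimes>\<^sub>m \<i> M) \<cdot> ?\<theta> X" .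
    have "(\<i> (?F Y) \<otimes>\<^sub>m (\<mu> Y \<cdot> ?R)) \<cdot> ev (?F X) (?F Y) =
        (\<i> (?F Y) \<otimes>\<^sub>m \<mu> Y) \<cdot> (\<i> (?F Y) \<otimes>\<^sub>m ?R) \<cdot> ev (?F X) (?F Y)"
      by simp
    also have "\<dots> = ?\<theta> Y \<cdot> amap F f"
      unfolding R(2) coend_coaction_def using M oS by (simp add: Ident_eq)
    finally have r: "(\<i> (?F Y) \<otimes>\<^sub>m (\<mu> Y \<cdot> ?R)) \<cdot> ev (?F X) (?F Y) = ?\<theta> Y \<cdot> amap F f" .
    have in_hom: "\<mu> X \<cdot> ?L \<in> hom C (h (?F X) (?F Y)) M" "\<mu> Y \<cdot> ?R \<in> hom C (h (?F X) (?F Y)) M"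
      by (simp_all add: hom_def)
    have "\<mu> X \<cdot> ?L = \<mu> Y \<cdot> ?R \<longleftrightarrow>
        (\<i> (?F Y) \<otimes>\<^sub>m (\<mu> X \<cdot> ?L)) \<cdot> ev (?F X) (?F Y) = (\<i> (?F Y) \<otimes>\<^sub>m (\<mu> Y \<cdot> ?R)) \<cdot> ev (?F X) (?F Y)"
      using cohom_ext[OF oS in_hom] by metis
    then show ?thesis
      using XY by (simp add: l r Cohom_func_def func_comp_def func_prod_def F.amap_Ident)
  qed
  have om: "omap ?G (X, X) = h (?F X) (?F X)" for X
    by (simp add: Cohom_func_def func_comp_def func_prod_def Cohom_def)
  have "cowedge D C ?G M \<mu> \<longleftrightarrow> (\<forall>X Y. \<forall>f \<in> hom D X Y.
      \<mu> X \<cdot> amap ?G (\<i>\<^bsub>D\<^esub> X, f) = \<mu> Y \<cdot> amap ?G (f, \<i>\<^bsub>D\<^esub> Y))"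
    using True M unfolding cowedge_def om by (auto simp: hom_def F.A.Dom_in F.A.Cod_in)
  then show ?thesis
    using True condition coend_coaction_in[OF F.omap_in]
    unfolding nat_trans_tensor_iff[OF monoidal_category_axioms functor_into_supercategory[OF F] M]
    by simp
qed

text \<open>Unfolding the comultiplication by its defining equation and moving the associator out
  identifies the transformation of the induced family as the double coaction. With
  \<open>\<mu> = i\<close> this is what \<open>\<Delta>\<close> classifies.\<close>

lemma coend_coaction_comult:
  assumes X: "omap F X \<in> Obj S" and \<mu>: "\<mu> X \<in> hom C (h (omap F X) (omap F X)) M"
  shows "coend_coaction C ev F (\<lambda>X. (\<mu> X \<otimes>\<^sub>m \<mu> X) \<cdot> cohom_comult C h ev (omap F X)) X =
    \<a> (omap F X) M M \<cdot> (coend_coaction C ev F \<mu> X \<otimes>\<^sub>m \<i> M) \<cdot> coend_coaction C ev F \<mu> X"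
    and "(\<mu> X \<otimes>\<^sub>m \<mu> X) \<cdot> cohom_comult C h ev (omap F X) \<in>
      hom C (h (omap F X) (omap F X)) (M \<otimes> M)"
proof -
  let ?F = "omap F X" let ?h = "h ?F ?F" and ?e = "ev ?F ?F"
  let ?c = "cohom_comult C h ev ?F"
  have [simp]: "?F \<in> Obj C" "?h \<in> Obj C" "?e \<in> Arr C" "Dom C ?e = ?F" "Cod C ?e = ?F \<otimes> ?h"
    using cohomD(1,2)[OF X X] X Obj_subset by (auto simp: hom_def)
  have \<mu>a [simp]: "\<mu> X \<in> Arr C" "Dom C (\<mu> X) = ?h" "Cod C (\<mu> X) = M" and [simp]: "M \<in> Obj C"
    using \<mu> Cod_in by (auto simp: hom_def)
  have "\<a> ?F ?h ?h \<cdot> (?e \<otimes>\<^sub>m \<i> ?h) \<cdot> ?e \<in> hom C ?F (?F \<otimes> ?h \<otimes> ?h)"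
    by (simp add: hom_def)
  note c = coact[OF X X _ this, folded cohom_comult_def, simplified]
  have ca [simp]: "?c \<in> Arr C" "Dom C ?c = ?h" "Cod C ?c = ?h \<otimes> ?h"
    using c(1) by (auto simp: hom_def)
  show "(\<mu> X \<otimes>\<^sub>m \<mu> X) \<cdot> ?c \<in> hom C ?h (M \<otimes> M)" by (simp add: hom_def)
  have "(\<i> ?F \<otimes>\<^sub>m ((\<mu> X \<otimes>\<^sub>m \<mu> X) \<cdot> ?c)) \<cdot> ?e = (\<i> ?F \<otimes>\<^sub>m \<mu> X \<otimes>\<^sub>m \<mu> X) \<cdot> (\<i> ?F \<otimes>\<^sub>m ?c) \<cdot> ?e"
    by simp
  also have "\<dots> = (\<i> ?F \<otimes>\<^sub>m \<mu> X \<otimes>\<^sub>m \<mu> X) \<cdot> \<a> ?F ?h ?h \<cdot> (?e \<otimes>\<^sub>m \<i> ?h) \<cdot> ?e"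
    by (simp only: c(2))
  also have "\<dots> = \<a> ?F M M \<cdot> (((\<i> ?F \<otimes>\<^sub>m \<mu> X) \<cdot> ?e) \<otimes>\<^sub>m \<i> M) \<cdot> (\<i> ?F \<otimes>\<^sub>m \<mu> X) \<cdot> ?e"
    by (subst assoc_natural_Comp) simp_all
  finally show "coend_coaction C ev F (\<lambda>X. (\<mu> X \<otimes>\<^sub>m \<mu> X) \<cdot> cohom_comult C h ev (omap F X)) X =
    \<a> ?F M M \<cdot> (coend_coaction C ev F \<mu> X \<otimes>\<^sub>m \<i> M) \<cdot> coend_coaction C ev F \<mu> X"
    by (simp only: coend_coaction_def)
qed

lemma coend_coaction_counit:
  assumes X: "omap F X \<in> Obj S"
  shows "coend_coaction C ev F (\<lambda>X. cohom_counit C h ev (omap F X)) X = inverse_arr C (\<r> (omap F X))"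
    and "cohom_counit C h ev (omap F X) \<in> hom C (h (omap F X) (omap F X)) \<one>"
proof -
  have "omap F X \<in> Obj C" using X Obj_subset by auto
  note c = coact[OF X X unit_in inverse_runit(1)[OF this], folded cohom_counit_def]
  show "coend_coaction C ev F (\<lambda>X. cohom_counit C h ev (omap F X)) X = inverse_arr C (\<r> (omap F X))"
    using c(2) by (simp add: coend_coaction_def)
  show "cohom_counit C h ev (omap F X) \<in> hom C (h (omap F X) (omap F X)) \<one>" by (rule c(1))
qed

text \<open>The universal property of the cohomomorphism objects turns \<open>\<theta>\<close> into
  a cowedge \<open>\<mu>\<close>; mediating arrows from \<open>i\<close> to \<open>\<mu>\<close> are
  exactly the factorisations of \<open>\<theta>\<close>, so initiality gives existence and
  uniqueness together.\<close>

lemma coend_universal: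
  assumes F: "cat_functor D S F" and coend: "is_coend D C (Cohom_func C h ev F) E i"
    and M: "M \<in> Obj C" and \<theta>: "nat_trans D C F (func_tensor C F M) \<theta>"
  shows "\<exists>!u. u \<in> hom C E M \<and>
    (\<forall>X \<in> Obj D. \<theta> X = (\<i> (omap F X) \<otimes>\<^sub>m u) \<cdot> coend_coaction C ev F i X)"
proof -
  interpret F: cat_functor D S F by fact
  have "cowedge D C (Cohom_func C h ev F) E i" using coend by (simp add: is_coend_def)
  then have E: "E \<in> Obj C" by (simp add: cowedge_def)
  have i: "i X \<in> hom C (h (omap F X) (omap F X)) E" if "X \<in> Obj D" for X
    using \<open>cowedge D C (Cohom_func C h ev F) E i\<close> that cowedge_iff_nat_trans[OF F E] by blast
  define \<mu> where "\<mu> X = coact C h ev (omap F X) (omap F X) M (\<theta> X)" for X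
  have \<theta>_in: "\<theta> X \<in> hom C (omap F X) (omap F X \<otimes> M)" if "X \<in> Obj D" for X
    using nat_trans.component_in[OF \<theta> that] by (simp add: func_tensor_def)
  have \<mu>: "\<mu> X \<in> hom C (h (omap F X) (omap F X)) M" "coend_coaction C ev F \<mu> X = \<theta> X"
    if "X \<in> Obj D" for X
    using coact[OF F.omap_in F.omap_in M \<theta>_in, OF that that that]
    by (simp_all add: \<mu>_def coend_coaction_def)
  have "nat_trans D C F (func_tensor C F M) (coend_coaction C ev F \<mu>)"
    using \<theta> \<mu>(2)
    unfolding nat_trans_tensor_iff[OF monoidal_category_axioms functor_into_supercategory[OF F] M]
    by (auto simp: hom_def F.A.Dom_in F.A.Cod_in)
  with \<mu>(1) have "cowedge D C (Cohom_func C h ev F) M \<mu>"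
    by (simp add: cowedge_iff_nat_trans[OF F M])
  then have *: "\<exists>!u. cowedge_morphism D C E i M \<mu> u"
    using coend by (simp add: is_coend_def)
  \<comment> \<open>Arrows out of \<open>cohom(F X, F X)\<close> are tested after coevaluation,
    which matches the two notions of factorisation object by object.\<close>
  have "u \<cdot> i X = \<mu> X \<longleftrightarrow> \<theta> X = (\<i> (omap F X) \<otimes>\<^sub>m u) \<cdot> coend_coaction C ev F i X"
    if u: "u \<in> hom C E M" and X: "X \<in> Obj D" for u X
  proof -
    have "u \<cdot> i X = \<mu> X \<longleftrightarrow> (\<i> (omap F X) \<otimes>\<^sub>m (u \<cdot> i X)) \<cdot> ev (omap F X) (omap F X) =
        (\<i> (omap F X) \<otimes>\<^sub>m \<mu> X) \<cdot> ev (omap F X) (omap F X)"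
      using cohom_ext[OF F.omap_in F.omap_in Comp_in[OF i u] \<mu>(1), OF X X X X] by auto
    also have "(\<i> (omap F X) \<otimes>\<^sub>m \<mu> X) \<cdot> ev (omap F X) (omap F X) = \<theta> X"
      using \<mu>(2)[OF X] by (simp add: coend_coaction_def)
    finally show ?thesis
      unfolding coend_coaction_Comp[of F X i E u M, OF F.omap_in[OF X] i[OF X] u] by auto
  qed
  then have "cowedge_morphism D C E i M \<mu> u \<longleftrightarrow> u \<in> hom C E M \<and>
      (\<forall>X \<in> Obj D. \<theta> X = (\<i> (omap F X) \<otimes>\<^sub>m u) \<cdot> coend_coaction C ev F i X)" for u
    by (auto simp: cowedge_morphism_def)
  with * show ?thesis by simp
qed

lemma coend_universal_coaction:
  assumes F: "cat_functor D S F" and coend: "is_coend D C (Cohom_func C h ev F) E i"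
  shows "universal_coaction C D F E (coend_coaction C ev F i)"
proof -
  interpret F: cat_functor D C F by (rule functor_into_supercategory[OF F])
  have cw: "cowedge D C (Cohom_func C h ev F) E i" using coend by (simp add: is_coend_def)
  then have E: "E \<in> Obj C" by (simp add: cowedge_def)
  have nat: "nat_trans D C F (func_tensor C F E) (coend_coaction C ev F i)"
    using cw cowedge_iff_nat_trans[OF F E] by blast
  \<comment> \<open>For \<open>coaction_ext\<close>, uniqueness in \<open>coend_universal\<close> is
    applied to this composite, which must first be known to be natural; \<open>u\<close> and
    \<open>v\<close> are then two factorisations of it.\<close>
  have comp: "nat_trans D C F (func_tensor C F M)
      (\<lambda>X. (\<i> (omap F X) \<otimes>\<^sub>m u) \<cdot> coend_coaction C ev F i X)"
    if u: "u \<in> hom C E M" for u M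
  proof -
    have M: "M \<in> Obj C" using u by (auto simp: hom_def)
    note iff = nat_trans_tensor_iff[OF monoidal_category_axioms F.cat_functor_axioms]
    let ?d = "coend_coaction C ev F i"
    have d: "?d X \<in> Arr C" "Dom C (?d X) = omap F X" "Cod C (?d X) = omap F X \<otimes> E"
      if "X \<in> Obj D" for X
      using nat that unfolding iff[OF E] by (auto simp: hom_def)
    have ua: "u \<in> Arr C" "Dom C u = E" "Cod C u = M" using u by (auto simp: hom_def)
    show ?thesis
      unfolding iff[OF M]
    proof (intro conjI allI ballI)
      fix X assume "X \<in> Obj D"
      then show "(\<i> (omap F X) \<otimes>\<^sub>m u) \<cdot> ?d X \<in> hom C (omap F X) (omap F X \<otimes> M)"
        using d ua F.omap_in by (simp add: hom_def)
    next
      fix X Y f assume f: "f \<in> hom D X Y"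
      then have o: "X \<in> Obj D" "Y \<in> Obj D" by (auto simp: hom_def F.A.Dom_in F.A.Cod_in)
      have fa: "amap F f \<in> Arr C" "Dom C (amap F f) = omap F X" "Cod C (amap F f) = omap F Y"
        using F.amap_in[OF f] by (auto simp: hom_def)
      note s = d[OF o(1)] d[OF o(2)] ua fa M E F.omap_in[OF o(1)] F.omap_in[OF o(2)]
      have "(amap F f \<otimes>\<^sub>m \<i> M) \<cdot> (\<i> (omap F X) \<otimes>\<^sub>m u) \<cdot> ?d X =
          (\<i> (omap F Y) \<otimes>\<^sub>m u) \<cdot> (amap F f \<otimes>\<^sub>m \<i> E) \<cdot> ?d X"
        using s by simp
      also have "(amap F f \<otimes>\<^sub>m \<i> E) \<cdot> ?d X = ?d Y \<cdot> amap F f"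
        using nat f unfolding iff[OF E] by blast
      also have "(\<i> (omap F Y) \<otimes>\<^sub>m u) \<cdot> ?d Y \<cdot> amap F f = ((\<i> (omap F Y) \<otimes>\<^sub>m u) \<cdot> ?d Y) \<cdot> amap F f"
        using s by simp
      finally show "(amap F f \<otimes>\<^sub>m \<i> M) \<cdot> (\<i> (omap F X) \<otimes>\<^sub>m u) \<cdot> ?d X =
        ((\<i> (omap F Y) \<otimes>\<^sub>m u) \<cdot> ?d Y) \<cdot> amap F f" .
    qed
  qed
  show ?thesis
  proof (intro universal_coaction.intro universal_coaction_axioms.intro monoidal_category_axioms
      F.cat_functor_axioms, goal_cases)
    case 1
    show ?case by (rule E)
  next
    case 2
    show ?case by (rule nat)
  next
    case (3 u M v)
    have "M \<in> Obj C" using 3(1) by (auto simp: hom_def)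
    from coend_universal[OF F coend this comp[OF 3(1)]] 3 show ?case by blast
  qed
qed

end

text \<open>One choice of \<open>\<Delta>\<close> and \<open>\<epsilon>\<close> serves (1) to (3).
  That they are induced is expressed by \<open>cowedge_morphism\<close>, which determines them
  because the coend is initial. Clause (5) is given with uniqueness of the factorisation.\<close>

theorem proposition1p13:
  fixes C :: "('o, 'm) moncat" and C0 :: "('o, 'm) cat" and D :: "('d, 'e) cat"
    and F :: "('d, 'e, 'o, 'm) func"
    and h :: "'o \<Rightarrow> 'o \<Rightarrow> 'o" and ev :: "'o \<Rightarrow> 'o \<Rightarrow> 'm"
    and E :: 'o and i :: "'d \<Rightarrow> 'm"
  assumes "monoidal_category C"
    and "subcategory C0 C"
    and "right_coclosed C C0"
    and "cohom_choice C C0 h ev"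
    and "category D"
    and "cat_functor D C0 F"
    and "is_coend D C (Cohom_func C h ev F) E i"
  shows "\<exists>\<Delta> \<epsilon>.
    (cowedge D C (Cohom_func C h ev F) (E \<otimes>\<^bsub>C\<^esub> E)
       (\<lambda>X. (i X \<otimes>\<^sub>m\<^bsub>C\<^esub> i X) \<cdot>\<^bsub>C\<^esub> cohom_comult C h ev (omap F X)) \<and>
     cowedge_morphism D C E i (E \<otimes>\<^bsub>C\<^esub> E)
       (\<lambda>X. (i X \<otimes>\<^sub>m\<^bsub>C\<^esub> i X) \<cdot>\<^bsub>C\<^esub> cohom_comult C h ev (omap F X)) \<Delta> \<and>
     cowedge D C (Cohom_func C h ev F) \<one>\<^bsub>C\<^esub> (\<lambda>X. cohom_counit C h ev (omap F X)) \<and>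
     cowedge_morphism D C E i \<one>\<^bsub>C\<^esub> (\<lambda>X. cohom_counit C h ev (omap F X)) \<epsilon> \<and>
     coalgebra C E \<Delta> \<epsilon>) \<and>
    (\<forall>X \<in> Obj D. right_comodule C E \<Delta> \<epsilon> (omap F X) (coend_coaction C ev F i X)) \<and>
    (\<forall>X \<in> Obj D. \<forall>Y \<in> Obj D. \<forall>\<phi> \<in> hom D X Y.
       comodule_morphism C E \<Delta> \<epsilon> (omap F X) (coend_coaction C ev F i X)
         (omap F Y) (coend_coaction C ev F i Y) (amap F \<phi>)) \<and>
    nat_trans D C F (func_tensor C F E) (coend_coaction C ev F i) \<and>
    (\<forall>M \<in> Obj C. \<forall>\<theta>. nat_trans D C F (func_tensor C F M) \<theta> \<longrightarrow>
       (\<exists>!u. u \<in> hom C E M \<and>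
         (\<forall>X \<in> Obj D. \<theta> X =
            (\<i>\<^bsub>C\<^esub> (omap F X) \<otimes>\<^sub>m\<^bsub>C\<^esub> u) \<cdot>\<^bsub>C\<^esub> coend_coaction C ev F i X)))"
proof -
  interpret right_coclosed_subcategory C C0 h ev
    using assms(1,2,4)
    by (simp add: right_coclosed_subcategory_def right_coclosed_subcategory_axioms_def)
  interpret F: cat_functor D C0 F by fact
  let ?G = "Cohom_func C h ev F" and ?\<delta> = "coend_coaction C ev F i"
  let ?\<mu>\<Delta> = "\<lambda>X. (i X \<otimes>\<^sub>m\<^bsub>C\<^esub> i X) \<cdot>\<^bsub>C\<^esub> cohom_comult C h ev (omap F X)"
    and ?\<mu>\<epsilon> = "\<lambda>X. cohom_counit C h ev (omap F X)"
  interpret U: universal_coaction C D F E ?\<delta>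
    by (rule coend_universal_coaction[OF assms(6,7)])
  have cw: "cowedge D C ?G E i" using assms(7) by (simp add: is_coend_def)
  then have i: "i X \<in> hom C (h (omap F X) (omap F X)) E" if "X \<in> Obj D" for X
    using that cowedge_iff_nat_trans[OF assms(6) U.E_in] by blast
  note comult = coend_coaction_comult[of F _ i, OF F.omap_in i]
  note counit = coend_coaction_counit[of F, OF F.omap_in]
  note nat_iff = nat_trans_tensor_iff[OF assms(1) U.F.cat_functor_axioms]
  \<comment> \<open>The formulas for comultiplication and counit hold at objects of \<open>D\<close>
    only; since \<open>nat_trans\<close> constrains components only there, agreement on
    \<open>Obj D\<close> is enough to transfer naturality.\<close>
  have nat_cong: "nat_trans D C F (func_tensor C F M) \<theta>'"
    if "nat_trans D C F (func_tensor C F M) \<theta>" "M \<in> Obj C" "\<And>X. X \<in> Obj D \<Longrightarrow> \<theta>' X = \<theta> X" for M \<theta> \<theta>'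
    using that(1,3) unfolding nat_iff[OF that(2)] by (auto simp: hom_def F.A.Dom_in F.A.Cod_in)
  have cw\<Delta>: "cowedge D C ?G (E \<otimes>\<^bsub>C\<^esub> E) ?\<mu>\<Delta>"
    unfolding cowedge_iff_nat_trans[OF assms(6) tensor_obj_in[OF U.E_in U.E_in]]
    using comult(2) nat_cong[OF U.double_coaction_natural _ comult(1)] by simp
  have cw\<epsilon>: "cowedge D C ?G \<one>\<^bsub>C\<^esub> ?\<mu>\<epsilon>"
    unfolding cowedge_iff_nat_trans[OF assms(6) unit_in]
    using counit(2) nat_cong[OF U.inverse_runit_nat_trans _ counit(1)] by simp
  obtain \<Delta> where m\<Delta>: "cowedge_morphism D C E i (E \<otimes>\<^bsub>C\<^esub> E) ?\<mu>\<Delta> \<Delta>"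
    using assms(7) cw\<Delta> unfolding is_coend_def by blast
  obtain \<epsilon> where m\<epsilon>: "cowedge_morphism D C E i \<one>\<^bsub>C\<^esub> ?\<mu>\<epsilon> \<epsilon>"
    using assms(7) cw\<epsilon> unfolding is_coend_def by blast
  \<comment> \<open>Translates a mediating arrow of cowedges into an equation between coactions; for
    \<open>\<Delta>\<close> and \<open>\<epsilon>\<close> this yields the hypotheses
    \<open>comult\<close> and \<open>counit\<close> of the abstract lemmas.\<close>
  have classify: "(\<i>\<^bsub>C\<^esub> (omap F X) \<otimes>\<^sub>m\<^bsub>C\<^esub> u) \<cdot>\<^bsub>C\<^esub> ?\<delta> X = coend_coaction C ev F \<mu> X"
    if "cowedge_morphism D C E i M \<mu> u" "X \<in> Obj D" for M \<mu> u X
    using coend_coaction_Comp[of F X i E u M] F.omap_in i that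
    by (simp add: cowedge_morphism_def coend_coaction_def)
  have in_hom: "\<Delta> \<in> hom C E (E \<otimes>\<^bsub>C\<^esub> E)" "\<epsilon> \<in> hom C E \<one>\<^bsub>C\<^esub>"
    using m\<Delta> m\<epsilon> by (auto simp: cowedge_morphism_def)
  note \<Delta>\<delta> = trans[OF classify[OF m\<Delta>] comult(1)] and \<epsilon>\<delta> = trans[OF classify[OF m\<epsilon>] counit(1)]
  have coalg: "coalgebra C E \<Delta> \<epsilon>"
    by (rule U.coalgebra_of_universal[OF in_hom \<Delta>\<delta> \<epsilon>\<delta>])
  have comod: "right_comodule C E \<Delta> \<epsilon> (omap F X) (?\<delta> X)" if "X \<in> Obj D" for X
    by (rule U.comodule_of_universal[OF in_hom \<Delta>\<delta> \<epsilon>\<delta> that])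
  \<comment> \<open>Colinearity of \<open>F \<phi>\<close> is the naturality square of
    \<open>\<delta>\<close> at \<open>\<phi>\<close>, so (3) and (4) rest on the same
    equation.\<close>
  have morphism: "comodule_morphism C E \<Delta> \<epsilon> (omap F X) (?\<delta> X) (omap F Y) (?\<delta> Y) (amap F \<phi>)"
    if "X \<in> Obj D" "Y \<in> Obj D" "\<phi> \<in> hom D X Y" for X Y \<phi>
    using comod that U.F.amap_in U.coaction_naturality
    by (simp add: comodule_morphism_def comodule_morphism_axioms_def)
  show ?thesis
    using cw\<Delta> m\<Delta> cw\<epsilon> m\<epsilon> coalg comod morphism U.coaction_natural coend_universal[OF assms(6,7)]
    by blast
qed

end
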